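(* Let $\Bbbk$ be a field with $\operatorname{char}\Bbbk=0$, let $H$ be a semisimple Hopf algebra over $\Bbbk$, let $V$ be a finite-dimensional vector space over $\Bbbk$, and suppose that the tensor algebra $T(V)$ of $V$ is an $H$-module algebra with a linear action of $H$. Then the Hilbert series $P(T(V)^H,z)=\sum_{n\in\mathbb{N}}(\dim T(V)_n^H)\,z^n$ of the subalgebra of invariants is a rational function with rational coefficients, that is, $P(T(V)^H,z)\in\mathbb{Q}(z)$.
   Context: All vector spaces, algebras and tensor products are over the field $\Bbbk$; $\mathbb{N}$ denotes the set of nonnegative integers. For a Hopf algebra $H$, $\Delta$ and $\varepsilon$ denote its comultiplication and counit, with Sweedler notation $\Delta(h)=\sum_{(h)}h_{(1)}\otimes h_{(2)}$. A Hopf algebra is semisimple if it is semisimple as an algebra. Given an $H$-module $V$, put $T(V)_0=\Bbbk$, viewed as the trivial $H$-module ($h\cdot 1=\varepsilon(h)1$), and $T(V)_n=V\otimes T(V)_{n-1}$ for $n\ge 1$, with $H$-action $h\cdot(v_1\otimes\cdots\otimes v_n)=\sum_{(h)}(h_{(1)}\cdot v_1)\otimes\cdots\otimes(h_{(n)}\cdot v_n)$. Then $T(V)=\bigoplus_{n\in\mathbb{N}}T(V)_n$, the tensor algebra of $V$, is an $H$-module algebra. An $H$-module algebra structure on $T(V)$ is called a linear action if it is induced in this way by an $H$-module structure on $V$. For an $H$-module $W$, $W^H=\{w\in W: h\cdot w=\varepsilon(h)w\text{ for all }h\in H\}$. For a linear action, $T(V)^H=\bigoplus_{n\in\mathbb{N}}T(V)_n^H$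 is a graded subalgebra of $T(V)$. For a graded algebra $A=\bigoplus_{n\in\mathbb{N}}A_n$ with all $A_n$ finite-dimensional, its Hilbert series is $P(A,z)=\sum_{n\in\mathbb{N}}(\dim A_n)z^n\in\mathbb{Z}[[z]]$. A power series $f\in\mathbb{Q}[[z]]$ is said to lie in $\mathbb{Q}(z)$ if there are polynomials $p,q\in\mathbb{Q}[z]$ with $q\neq 0$ and $qf=p$ in $\mathbb{Q}[[z]]$. *)

theory Defs
  imports "HOL-Computational_Algebra.Computational_Algebra"
begin

section \<open>Tensor powers and the tensor algebra\<close>

text \<open>
  A family of multilinear maps, one for each number of arguments: the restriction of \<open>f\<close> to
  lists of length \<open>n\<close> is \<open>n\<close>-linear.
\<close>

definition multilinear ::
    "('k::field \<Rightarrow> 'v::ab_group_add \<Rightarrow> 'v) \<Rightarrow> ('k \<Rightarrow> 'x::ab_group_add \<Rightarrow> 'x) \<Rightarrow> ('v list \<Rightarrow> 'x) \<Rightarrow> bool"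
  where "multilinear sV sX f \<longleftrightarrow> (\<forall>us ws. Vector_Spaces.linear sV sX (\<lambda>v. f (us @ v # ws)))"

text \<open>
  The tensor \<open>v\<^sub>1 \<otimes> \<dots> \<otimes> v\<^sub>n\<close> is realised as the functional
  \<open>\<phi> \<mapsto> \<phi> (v\<^sub>1, \<dots>, v\<^sub>n)\<close> on multilinear forms, and \<open>T(V)\<close> as the span of these tensors
  (of all lengths; tensors of different lengths are independent because the components of a
  multilinear family are). Over a field this is the usual tensor algebra; the universal property
  is proved below.
\<close>

typedef ('v, 'k) tensor = "UNIV :: (('v list \<Rightarrow> 'k) \<Rightarrow> 'k) set"
  morphisms apply_tensor Tensor ..

setup_lifting type_definition_tensor

instantiation tensor :: (type, ab_group_add) ab_group_add
begin

lift_definition zero_tensor :: "('a, 'b) tensor" is "\<lambda>\<phi>. 0" .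
lift_definition plus_tensor :: "('a, 'b) tensor \<Rightarrow> ('a, 'b) tensor \<Rightarrow> ('a, 'b) tensor"
  is "\<lambda>s t \<phi>. s \<phi> + t \<phi>" .
lift_definition minus_tensor :: "('a, 'b) tensor \<Rightarrow> ('a, 'b) tensor \<Rightarrow> ('a, 'b) tensor"
  is "\<lambda>s t \<phi>. s \<phi> - t \<phi>" .
lift_definition uminus_tensor :: "('a, 'b) tensor \<Rightarrow> ('a, 'b) tensor"
  is "\<lambda>t \<phi>. - t \<phi>" .

instance
  by standard (transfer; simp add: algebra_simps)+

end

lift_definition tensor_scale :: "'k::field \<Rightarrow> ('v, 'k) tensor \<Rightarrow> ('v, 'k) tensor"
  is "\<lambda>c t \<phi>. c * t \<phi>" .

lift_definition tens :: "('k::field \<Rightarrow> 'v::ab_group_add \<Rightarrow> 'v) \<Rightarrow> 'v list \<Rightarrow> ('v, 'k) tensor"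
  is "\<lambda>sV vs \<phi>. if multilinear sV (*) \<phi> then \<phi> vs else 0" .

definition tensor_power :: "('k::field \<Rightarrow> 'v::ab_group_add \<Rightarrow> 'v) \<Rightarrow> nat \<Rightarrow> ('v, 'k) tensor set"
  where "tensor_power sV n = module.span tensor_scale {tens sV vs | vs. length vs = n}"

definition tensor_algebra :: "('k::field \<Rightarrow> 'v::ab_group_add \<Rightarrow> 'v) \<Rightarrow> ('v, 'k) tensor set"
  where "tensor_algebra sV = module.span tensor_scale (range (tens sV))"

text \<open>
  The linear map on \<open>T(V)\<close> induced by a multilinear family \<open>f\<close>; its values outside \<open>T(V)\<close>
  are irrelevant.
\<close>

definition tensor_lift ::
    "('k::field \<Rightarrow> 'v::ab_group_add \<Rightarrow> 'v) \<Rightarrow> ('k \<Rightarrow> 'x::ab_group_add \<Rightarrow> 'x) \<Rightarrow>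
     ('v list \<Rightarrow> 'x) \<Rightarrow> ('v, 'k) tensor \<Rightarrow> 'x"
  where "tensor_lift sV sX f =
    (SOME L. Vector_Spaces.linear tensor_scale sX L \<and> (\<forall>vs. L (tens sV vs) = f vs))"

definition tensor_mult ::
    "('k::field \<Rightarrow> 'v::ab_group_add \<Rightarrow> 'v) \<Rightarrow> ('v, 'k) tensor \<Rightarrow> ('v, 'k) tensor \<Rightarrow> ('v, 'k) tensor"
  where "tensor_mult sV x y =
    tensor_lift sV tensor_scale (\<lambda>us. tensor_lift sV tensor_scale (\<lambda>ws. tens sV (us @ ws)) y) x"


section \<open>Hopf algebras\<close>

locale k_algebra = vector_space scale
  for scale :: "'k::field \<Rightarrow> 'h::ring_1 \<Rightarrow> 'h" +
  assumes scale_mult_left: "scale c x * y = scale c (x * y)"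
    and scale_mult_right: "x * scale c y = scale c (x * y)"

text \<open>
  Sweedler notation: for a bilinear map \<open>f\<close> into a vector space with scaling \<open>sX\<close>,
  \<open>sweedler sH \<Delta> sX f h\<close> stands for \<open>\<Sum>\<^bsub>(h)\<^esub> f h\<^sub>(\<^sub>1\<^sub>) h\<^sub>(\<^sub>2\<^sub>)\<close>, where \<open>\<Delta> h \<in> H \<otimes> H\<close>.
\<close>

definition bilinear_family :: "('h \<Rightarrow> 'h \<Rightarrow> 'x::zero) \<Rightarrow> 'h list \<Rightarrow> 'x"
  where "bilinear_family f hs = (case hs of [a, b] \<Rightarrow> f a b | _ \<Rightarrow> 0)"

definition sweedler ::
    "('k::field \<Rightarrow> 'h::ab_group_add \<Rightarrow> 'h) \<Rightarrow> ('h \<Rightarrow> ('h, 'k) tensor) \<Rightarrow>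
     ('k \<Rightarrow> 'x::ab_group_add \<Rightarrow> 'x) \<Rightarrow> ('h \<Rightarrow> 'h \<Rightarrow> 'x) \<Rightarrow> 'h \<Rightarrow> 'x"
  where "sweedler sH \<Delta> sX f h = tensor_lift sH sX (bilinear_family f) (\<Delta> h)"

locale hopf_algebra = k_algebra sH
  for sH :: "'k::field \<Rightarrow> 'h::ring_1 \<Rightarrow> 'h" +
  fixes \<Delta> :: "'h \<Rightarrow> ('h, 'k) tensor" and \<epsilon> :: "'h \<Rightarrow> 'k" and S :: "'h \<Rightarrow> 'h"
  assumes comult_in: "\<Delta> h \<in> tensor_power sH 2"
    and comult_linear: "Vector_Spaces.linear sH tensor_scale \<Delta>"
    and counit_linear: "Vector_Spaces.linear sH (*) \<epsilon>"
    and antipode_linear: "Vector_Spaces.linear sH sH S"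
    and coassoc:
      "sweedler sH \<Delta> tensor_scale
         (\<lambda>a b. sweedler sH \<Delta> tensor_scale (\<lambda>a1 a2. tens sH [a1, a2, b]) a) h =
       sweedler sH \<Delta> tensor_scale
         (\<lambda>a b. sweedler sH \<Delta> tensor_scale (\<lambda>b1 b2. tens sH [a, b1, b2]) b) h"
    and counit_left: "sweedler sH \<Delta> sH (\<lambda>a b. sH (\<epsilon> a) b) h = h"
    and counit_right: "sweedler sH \<Delta> sH (\<lambda>a b. sH (\<epsilon> b) a) h = h"
    and comult_mult: "\<Delta> (g * h) =
       sweedler sH \<Delta> tensor_scale
         (\<lambda>a b. sweedler sH \<Delta> tensor_scale (\<lambda>c d. tens sH [a * c, b * d]) h) g"
    and comult_one: "\<Delta> 1 = tens sH [1, 1]"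
    and counit_mult: "\<epsilon> (g * h) = \<epsilon> g * \<epsilon> h"
    and counit_one: "\<epsilon> 1 = 1"
    and antipode_left: "sweedler sH \<Delta> sH (\<lambda>a b. S a * b) h = sH (\<epsilon> h) 1"
    and antipode_right: "sweedler sH \<Delta> sH (\<lambda>a b. a * S b) h = sH (\<epsilon> h) 1"

text \<open>
  An algebra is semisimple if its left regular module is: every left ideal is a direct summand.
  (Left ideals of a unital algebra are automatically linear subspaces.)
\<close>

definition left_ideal :: "'h::ring_1 set \<Rightarrow> bool"
  where "left_ideal I \<longleftrightarrow>
    0 \<in> I \<and> (\<forall>x\<in>I. \<forall>y\<in>I. x + y \<in> I) \<and> (\<forall>a. \<forall>x\<in>I. a * x \<in> I)"

definition semisimple_algebra :: "'h::ring_1 itself \<Rightarrow> bool"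
  where "semisimple_algebra _ \<longleftrightarrow>
    (\<forall>I :: 'h set. left_ideal I \<longrightarrow>
      (\<exists>J. left_ideal J \<and> I \<inter> J = {0} \<and> (\<forall>x. \<exists>i\<in>I. \<exists>j\<in>J. x = i + j)))"


section \<open>Module algebras and linear actions\<close>

locale algebra_module = k_algebra sH + M: vector_space sM
  for sH :: "'k::field \<Rightarrow> 'h::ring_1 \<Rightarrow> 'h" and sM :: "'k \<Rightarrow> 'm::ab_group_add \<Rightarrow> 'm" +
  fixes M :: "'m set" and act :: "'h \<Rightarrow> 'm \<Rightarrow> 'm"
  assumes subspace: "module.subspace sM M"
    and act_closed: "x \<in> M \<Longrightarrow> act h x \<in> M"
    and act_add_right: "x \<in> M \<Longrightarrow> y \<in> M \<Longrightarrow> act h (x + y) = act h x + act h y"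
    and act_scale_right: "x \<in> M \<Longrightarrow> act h (sM c x) = sM c (act h x)"
    and act_add_left: "x \<in> M \<Longrightarrow> act (g + h) x = act g x + act h x"
    and act_scale_left: "x \<in> M \<Longrightarrow> act (sH c h) x = sM c (act h x)"
    and act_one: "x \<in> M \<Longrightarrow> act 1 x = x"
    and act_mult: "x \<in> M \<Longrightarrow> act (g * h) x = act g (act h x)"

locale algebra_on = vector_space sA
  for sA :: "'k::field \<Rightarrow> 'a::ab_group_add \<Rightarrow> 'a" +
  fixes A :: "'a set" and mult :: "'a \<Rightarrow> 'a \<Rightarrow> 'a" and unit :: 'a
  assumes algebra_subspace: "module.subspace sA A"
    and mult_closed: "x \<in> A \<Longrightarrow> y \<in> A \<Longrightarrow> mult x y \<in> A"
    and unit_closed: "unit \<in> A"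
    and mult_add_left: "x \<in> A \<Longrightarrow> y \<in> A \<Longrightarrow> z \<in> A \<Longrightarrow> mult (x + y) z = mult x z + mult y z"
    and mult_add_right: "x \<in> A \<Longrightarrow> y \<in> A \<Longrightarrow> z \<in> A \<Longrightarrow> mult x (y + z) = mult x y + mult x z"
    and mult_scale_left: "x \<in> A \<Longrightarrow> y \<in> A \<Longrightarrow> mult (sA c x) y = sA c (mult x y)"
    and mult_scale_right: "x \<in> A \<Longrightarrow> y \<in> A \<Longrightarrow> mult x (sA c y) = sA c (mult x y)"
    and mult_assoc: "x \<in> A \<Longrightarrow> y \<in> A \<Longrightarrow> z \<in> A \<Longrightarrow> mult (mult x y) z = mult x (mult y z)"
    and mult_unit_left: "x \<in> A \<Longrightarrow> mult unit x = x"
    and mult_unit_right: "x \<in> A \<Longrightarrow> mult x unit = x"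

locale module_algebra = algebra_module sH sA A act + algebra_on sA A mult unit
  for sH :: "'k::field \<Rightarrow> 'h::ring_1 \<Rightarrow> 'h"
    and \<Delta> :: "'h \<Rightarrow> ('h, 'k) tensor" and \<epsilon> :: "'h \<Rightarrow> 'k"
    and sA :: "'k \<Rightarrow> 'a::ab_group_add \<Rightarrow> 'a" and A :: "'a set"
    and mult :: "'a \<Rightarrow> 'a \<Rightarrow> 'a" and unit :: 'a and act :: "'h \<Rightarrow> 'a \<Rightarrow> 'a" +
  assumes act_algebra_unit: "act h unit = sA (\<epsilon> h) unit"
    and act_algebra_mult: "x \<in> A \<Longrightarrow> y \<in> A \<Longrightarrow>
      act h (mult x y) = sweedler sH \<Delta> sA (\<lambda>a b. mult (act a x) (act b y)) h"

text \<open>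
  \<open>\<Sum>\<^bsub>(h)\<^esub> (h\<^sub>(\<^sub>1\<^sub>) v\<^sub>1) \<otimes> \<dots> \<otimes> (h\<^sub>(\<^sub>n\<^sub>) v\<^sub>n)\<close>, following the recursion
  \<open>T(V)\<^sub>n = V \<otimes> T(V)\<^sub>n\<^sub>-\<^sub>1\<close>; on \<open>T(V)\<^sub>0\<close> the action is trivial.
\<close>

primrec diagonal_action ::
    "('k::field \<Rightarrow> 'h::ring_1 \<Rightarrow> 'h) \<Rightarrow> ('h \<Rightarrow> ('h, 'k) tensor) \<Rightarrow> ('h \<Rightarrow> 'k) \<Rightarrow>
     ('k \<Rightarrow> 'v::ab_group_add \<Rightarrow> 'v) \<Rightarrow> ('h \<Rightarrow> 'v \<Rightarrow> 'v) \<Rightarrow> 'v list \<Rightarrow> 'h \<Rightarrow> ('v, 'k) tensor"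
  where
    "diagonal_action sH \<Delta> \<epsilon> sV \<rho> [] = (\<lambda>h. tensor_scale (\<epsilon> h) (tens sV []))"
  | "diagonal_action sH \<Delta> \<epsilon> sV \<rho> (v # vs) = (\<lambda>h.
       sweedler sH \<Delta> tensor_scale
         (\<lambda>a b. tensor_mult sV (tens sV [\<rho> a v]) (diagonal_action sH \<Delta> \<epsilon> sV \<rho> vs b)) h)"

definition linear_action ::
    "('k::field \<Rightarrow> 'h::ring_1 \<Rightarrow> 'h) \<Rightarrow> ('h \<Rightarrow> ('h, 'k) tensor) \<Rightarrow> ('h \<Rightarrow> 'k) \<Rightarrow>
     ('k \<Rightarrow> 'v::ab_group_add \<Rightarrow> 'v) \<Rightarrow> ('h \<Rightarrow> ('v, 'k) tensor \<Rightarrow> ('v, 'k) tensor) \<Rightarrow> bool"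
  where "linear_action sH \<Delta> \<epsilon> sV act \<longleftrightarrow>
    module_algebra sH \<Delta> \<epsilon> tensor_scale (tensor_algebra sV) (tensor_mult sV) (tens sV []) act \<and>
    (\<exists>\<rho>. algebra_module sH sV UNIV \<rho> \<and>
         (\<forall>h vs. act h (tens sV vs) = diagonal_action sH \<Delta> \<epsilon> sV \<rho> vs h))"

definition invariants ::
    "('h \<Rightarrow> 'k) \<Rightarrow> ('k \<Rightarrow> 'm \<Rightarrow> 'm) \<Rightarrow> 'm set \<Rightarrow> ('h \<Rightarrow> 'm \<Rightarrow> 'm) \<Rightarrow> 'm set"
  where "invariants \<epsilon> sM M act = {x \<in> M. \<forall>h. act h x = sM (\<epsilon> h) x}"

definition hilbert_series ::
    "('k::field \<Rightarrow> 'a::ab_group_add \<Rightarrow> 'a) \<Rightarrow> (nat \<Rightarrow> 'a set) \<Rightarrow> rat fps"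
  where "hilbert_series sA A = Abs_fps (\<lambda>n. of_nat (vector_space.dim sA (A n)))"

section \<open>The universal property of the tensor algebra\<close>

lemma vector_space_tensor_scale: "vector_space (tensor_scale :: 'k::field \<Rightarrow> ('v, 'k) tensor \<Rightarrow> _)"
  by unfold_locales (transfer; simp add: algebra_simps fun_eq_iff)+

lemma vector_space_self: "vector_space ((*) :: 'k::field \<Rightarrow> 'k \<Rightarrow> 'k)"
  by unfold_locales (simp_all add: algebra_simps)

lemma linearI':
  assumes "vector_space s1" "vector_space s2" "\<And>x y. f (x + y) = f x + f y"
    "\<And>c x. f (s1 c x) = s2 c (f x)"
  shows "Vector_Spaces.linear s1 s2 f"
  unfolding module_hom_iff_linear[symmetric]
  using assms by (simp add: module_hom_def module_hom_axioms_def module_iff_vector_space)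

lemma linearD:
  assumes "Vector_Spaces.linear s1 s2 f"
  shows "vector_space s1" "vector_space s2" "f (x + y) = f x + f y" "f (s1 c x) = s2 c (f x)"
    "f 0 = 0"
proof -
  interpret Vector_Spaces.linear s1 s2 f by fact
  show "vector_space s1" "vector_space s2" by unfold_locales
  show "f (x + y) = f x + f y" "f (s1 c x) = s2 c (f x)" "f 0 = 0"
    by (simp_all add: add scale)
qed

lemma linear_compose':
  assumes "Vector_Spaces.linear s2 s3 g" "Vector_Spaces.linear s1 s2 f"
  shows "Vector_Spaces.linear s1 s3 (\<lambda>x. g (f x))"
  by (rule linearI') (simp_all add: linearD[OF assms(1)] linearD[OF assms(2)])

lemma linear_zero':
  "vector_space s1 \<Longrightarrow> vector_space s2 \<Longrightarrow> Vector_Spaces.linear s1 s2 (\<lambda>x. 0)"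
  by (rule linearI') (simp_all add: module.scale_zero_right module_iff_vector_space)

lemma linear_add':
  assumes "Vector_Spaces.linear s1 s2 f" "Vector_Spaces.linear s1 s2 g"
  shows "Vector_Spaces.linear s1 s2 (\<lambda>x. f x + g x)"
  by (rule linearI')
    (simp_all add: linearD[OF assms(1)] linearD[OF assms(2)]
      vector_space.vector_space_assms[OF linearD(2)[OF assms(1)]])

lemma linear_scale':
  assumes "Vector_Spaces.linear s1 s2 f"
  shows "Vector_Spaces.linear s1 s2 (\<lambda>x. s2 c (f x))"
  by (rule linearI')
    (simp_all add: linearD[OF assms(1)] mult.commute
      vector_space.vector_space_assms[OF linearD(2)[OF assms(1)]])

lemma linear_scale_left':
  assumes "Vector_Spaces.linear s1 (*) f" "vector_space s2"
  shows "Vector_Spaces.linear s1 s2 (\<lambda>x. s2 (f x) v)"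
  by (rule linearI')
    (simp_all add: linearD[OF assms(1)] assms vector_space.vector_space_assms[OF assms(2)])

lemma multilinearD: "multilinear sV sX f \<Longrightarrow> Vector_Spaces.linear sV sX (\<lambda>v. f (us @ v # ws))"
  by (simp add: multilinear_def)

lemma multilinear_vs:
  assumes "multilinear sV sX f"
  shows "vector_space sV" "vector_space sX"
  using linearD[OF multilinearD[OF assms]] by auto

lemma functional_separates:
  fixes sX :: "'k::field \<Rightarrow> 'x::ab_group_add \<Rightarrow> 'x"
  assumes "vector_space sX" "\<And>\<xi>. Vector_Spaces.linear sX (*) \<xi> \<Longrightarrow> \<xi> x = \<xi> y"
  shows "x = y"
proof (rule ccontr)
  assume "x \<noteq> y"
  interpret vector_space_pair sX "(*) :: 'k \<Rightarrow> 'k \<Rightarrow> 'k"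
    using assms(1) vector_space_self by (simp add: vector_space_pair_def)
  have "vs1.independent {x - y}"
    using \<open>x \<noteq> y\<close> by (simp add: vs1.dependent_single)
  from linear_independent_extend[OF this, of "\<lambda>_. 1"] obtain \<xi>
    where \<xi>: "Vector_Spaces.linear sX (*) \<xi>" "\<xi> (x - y) = (1 :: 'k)"
    by auto
  have "\<xi> (x - y) = \<xi> x - \<xi> y"
    using linearD(3)[OF \<xi>(1), of "x - y" y] by simp
  with assms(2)[OF \<xi>(1)] \<xi>(2) show False by simp
qed

lemma tensor_lift_exists:
  fixes sV :: "'k::field \<Rightarrow> 'v::ab_group_add \<Rightarrow> 'v" and sX :: "'k \<Rightarrow> 'x::ab_group_add \<Rightarrow> 'x"
  assumes f: "multilinear sV sX f"
  shows "\<exists>L. Vector_Spaces.linear tensor_scale sX L \<and> (\<forall>vs. L (tens sV vs) = f vs)"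
proof -
  interpret vector_space_pair "tensor_scale :: 'k \<Rightarrow> ('v, 'k) tensor \<Rightarrow> _" sX
    using multilinear_vs[OF f] vector_space_tensor_scale by (simp add: vector_space_pair_def)
  obtain B where B: "B \<subseteq> range (tens sV)" "vs1.independent B" "range (tens sV) \<subseteq> vs1.span B"
    using vs1.maximal_independent_subset[of "range (tens sV)"] by metis
  define r where "r = (\<lambda>b. SOME vs. b = tens sV vs)"
  have r: "tens sV (r b) = b" if "b \<in> B" for b
    using that B(1) unfolding r_def by (metis (mono_tags, lifting) imageE someI subsetD)
  from linear_independent_extend[OF B(2), of "\<lambda>b. f (r b)"] obtain L
    where L: "Vector_Spaces.linear tensor_scale sX L" "\<And>b. b \<in> B \<Longrightarrow> L b = f (r b)"
    by auto
  have key: "\<xi> (L t) = apply_tensor t (\<lambda>vs. \<xi> (f vs))"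
    if \<xi>: "Vector_Spaces.linear sX (*) \<xi>" and t: "t \<in> vs1.span B" for \<xi> t
    using t
  proof (induction rule: vs1.span_induct_alt)
    case base
    show ?case by (simp add: linearD(5)[OF L(1)] linearD(5)[OF \<xi>] zero_tensor.rep_eq)
  next
    case (step c b y)
    have ml: "multilinear sV (*) (\<lambda>vs. \<xi> (f vs))"
      unfolding multilinear_def
      by (intro allI linear_compose'[OF \<xi>] multilinearD[OF f])
    have "apply_tensor b (\<lambda>vs. \<xi> (f vs)) = apply_tensor (tens sV (r b)) (\<lambda>vs. \<xi> (f vs))"
      using r[OF step(1)] by simp
    also have "\<dots> = \<xi> (f (r b))"
      using ml by (simp add: tens.rep_eq)
    finally show ?case
      using step by (simp add: linearD[OF L(1)] linearD[OF \<xi>] L(2)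
        tensor_scale.rep_eq plus_tensor.rep_eq)
  qed
  have "L (tens sV vs) = f vs" for vs
  proof (rule functional_separates[OF vs2.vector_space_axioms])
    fix \<xi> :: "'x \<Rightarrow> 'k"
    assume \<xi>: "Vector_Spaces.linear sX (*) \<xi>"
    have ml: "multilinear sV (*) (\<lambda>vs. \<xi> (f vs))"
      unfolding multilinear_def
      by (intro allI linear_compose'[OF \<xi>] multilinearD[OF f])
    have "\<xi> (L (tens sV vs)) = apply_tensor (tens sV vs) (\<lambda>vs. \<xi> (f vs))"
      by (rule key[OF \<xi>]) (use B(3) in auto)
    also have "\<dots> = \<xi> (f vs)"
      using ml by (simp add: tens.rep_eq)
    finally show "\<xi> (L (tens sV vs)) = \<xi> (f vs)" .
  qed
  with L(1) show ?thesis by blast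
qed

lemma tensor_lift_linear:
    "multilinear sV sX f \<Longrightarrow> Vector_Spaces.linear tensor_scale sX (tensor_lift sV sX f)"
  and tensor_lift_tens: "multilinear sV sX f \<Longrightarrow> tensor_lift sV sX f (tens sV vs) = f vs"
  using someI_ex[OF tensor_lift_exists, of sV sX f] unfolding tensor_lift_def by auto

lemma tens_in: "tens sV vs \<in> tensor_algebra sV"
  unfolding tensor_algebra_def
  by (rule module.span_base) (simp_all add: module_iff_vector_space vector_space_tensor_scale)

lemma tensor_algebra_subspace: "module.subspace tensor_scale (tensor_algebra sV)"
  unfolding tensor_algebra_def
  by (rule module.subspace_span) (simp add: module_iff_vector_space vector_space_tensor_scale)

lemma tensor_algebra_add:
    "x \<in> tensor_algebra sV \<Longrightarrow> y \<in> tensor_algebra sV \<Longrightarrow> x + y \<in> tensor_algebra sV"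
  and tensor_algebra_scale: "x \<in> tensor_algebra sV \<Longrightarrow> tensor_scale c x \<in> tensor_algebra sV"
  and tensor_algebra_zero: "0 \<in> tensor_algebra sV"
  using tensor_algebra_subspace[of sV]
  by (simp_all add: module.subspace_def module_iff_vector_space vector_space_tensor_scale)

lemma tensor_power_subset: "tensor_power sV n \<subseteq> tensor_algebra sV"
  unfolding tensor_power_def tensor_algebra_def
  by (rule module.span_mono) (auto simp: module_iff_vector_space vector_space_tensor_scale)

lemma tensor_algebra_induct [consumes 1, case_names zero step]:
  assumes "t \<in> tensor_algebra sV" "P 0"
    "\<And>c vs y. y \<in> tensor_algebra sV \<Longrightarrow> P y \<Longrightarrow> P (tensor_scale c (tens sV vs) + y)"
  shows "P t"
proof -
  interpret vector_space tensor_scale by (rule vector_space_tensor_scale)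
  have "t \<in> tensor_algebra sV \<and> P t"
    using assms(1)[unfolded tensor_algebra_def]
  proof (induction rule: span_induct_alt)
    case base
    then show ?case using assms(2) by (simp add: tensor_algebra_zero)
  next
    case (step c x y)
    then show ?case
      using assms(3) tensor_algebra_add tensor_algebra_scale tens_in by fastforce
  qed
  then show ?thesis by simp
qed

lemma tensor_linear_eqI:
  assumes "Vector_Spaces.linear tensor_scale sX L" "Vector_Spaces.linear tensor_scale sX L'"
    "\<And>vs. L (tens sV vs) = L' (tens sV vs)" "t \<in> tensor_algebra sV"
  shows "L t = L' t"
  using assms(4)
  by (induction rule: tensor_algebra_induct)
    (simp_all add: linearD[OF assms(1)] linearD[OF assms(2)] assms(3))

section \<open>Existence of linear actions\<close>

text \<open>
  Every \<open>H\<close>-module structure on \<open>V\<close> induces a linear action on \<open>T(V)\<close>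
  (\<open>linear_action_induced\<close>), so \<open>linear_action\<close> imposes nothing beyond the choice of
  such a structure.
\<close>

lemma tensor_lift_param:
  assumes F: "\<And>p. multilinear sV sX (F p)"
    and lin: "\<And>vs. Vector_Spaces.linear sP sX (\<lambda>p. F p vs)"
    and t: "t \<in> tensor_algebra sV"
  shows "Vector_Spaces.linear sP sX (\<lambda>p. tensor_lift sV sX (F p) t)"
  using t
proof (induction rule: tensor_algebra_induct)
  case zero
  show ?case
    using linear_zero'[OF linearD(1,2)[OF lin]] by (simp add: linearD(5)[OF tensor_lift_linear[OF F]])
next
  case (step c vs y)
  show ?case
    by (simp only: linearD[OF tensor_lift_linear[OF F]] tensor_lift_tens[OF F])
      (intro linear_add' linear_scale' lin step.IH)
qed

lemma tensor_lift_closed: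
  assumes f: "multilinear sV sX f" and "module.subspace sX A" "\<And>vs. f vs \<in> A"
    and t: "t \<in> tensor_algebra sV"
  shows "tensor_lift sV sX f t \<in> A"
proof -
  have m: "module sX"
    using linearD(2)[OF tensor_lift_linear[OF f]] by (simp add: module_iff_vector_space)
  show ?thesis
    using t
  proof (induction rule: tensor_algebra_induct)
    case zero
    then show ?case
      using assms(2) m by (simp add: linearD(5)[OF tensor_lift_linear[OF f]] module.subspace_0)
  next
    case (step c vs y)
    then show ?case
      using assms(2,3) m
      by (simp add: linearD[OF tensor_lift_linear[OF f]] tensor_lift_tens[OF f]
          module.subspace_add module.subspace_scale)
  qed
qed

lemma multilinear_add:
  "multilinear sV sX f \<Longrightarrow> multilinear sV sX g \<Longrightarrow> multilinear sV sX (\<lambda>vs. f vs + g vs)"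
  by (simp add: multilinear_def linear_add')

lemma multilinear_scale:
  "multilinear sV sX f \<Longrightarrow> multilinear sV sX (\<lambda>vs. sX c (f vs))"
  unfolding multilinear_def by (intro allI linear_scale') simp

lemma multilinear_zero:
  "vector_space sV \<Longrightarrow> vector_space sX \<Longrightarrow> multilinear sV sX (\<lambda>vs. 0)"
  by (simp add: multilinear_def linear_zero')

lemma tensor_lift_add:
  assumes "multilinear sV sX f" "multilinear sV sX g" "t \<in> tensor_algebra sV"
  shows "tensor_lift sV sX (\<lambda>vs. f vs + g vs) t = tensor_lift sV sX f t + tensor_lift sV sX g t"
  by (rule tensor_linear_eqI[OF tensor_lift_linear linear_add'[OF tensor_lift_linear tensor_lift_linear]])
    (use assms in \<open>simp_all add: tensor_lift_tens multilinear_add\<close>)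

lemma tensor_lift_scale:
  assumes "multilinear sV sX f" "t \<in> tensor_algebra sV"
  shows "tensor_lift sV sX (\<lambda>vs. sX c (f vs)) t = sX c (tensor_lift sV sX f t)"
  by (rule tensor_linear_eqI[OF tensor_lift_linear linear_scale'[OF tensor_lift_linear]])
    (use assms in \<open>simp_all add: tensor_lift_tens multilinear_scale\<close>)

lemma tensor_lift_zero:
  assumes "vector_space sV" "vector_space sX" "t \<in> tensor_algebra sV"
  shows "tensor_lift sV sX (\<lambda>vs. 0) t = 0"
  by (rule tensor_linear_eqI[OF tensor_lift_linear linear_zero'])
    (use assms in \<open>simp_all add: tensor_lift_tens multilinear_zero vector_space_tensor_scale\<close>)

lemma tensor_lift_compose:
  assumes "multilinear sV sX f" "Vector_Spaces.linear sX sY L" "t \<in> tensor_algebra sV"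
  shows "L (tensor_lift sV sX f t) = tensor_lift sV sY (\<lambda>vs. L (f vs)) t"
proof -
  have m: "multilinear sV sY (\<lambda>vs. L (f vs))"
    using assms by (auto simp: multilinear_def intro: linear_compose')
  show ?thesis
    by (rule tensor_linear_eqI[OF linear_compose'[OF assms(2) tensor_lift_linear[OF assms(1)]]
          tensor_lift_linear[OF m] _ assms(3)])
      (simp add: tensor_lift_tens m assms(1))
qed

lemma tensor_lift_fubini:
  assumes F: "\<And>vs. multilinear sW sX (F vs)" "\<And>ws. multilinear sV sX (\<lambda>vs. F vs ws)"
    and s: "s \<in> tensor_algebra sV" and t: "t \<in> tensor_algebra sW"
  shows "tensor_lift sV sX (\<lambda>vs. tensor_lift sW sX (F vs) t) s =
    tensor_lift sW sX (\<lambda>ws. tensor_lift sV sX (\<lambda>vs. F vs ws) s) t"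
proof -
  have m1: "multilinear sV sX (\<lambda>vs. tensor_lift sW sX (F vs) t)"
    unfolding multilinear_def
    by (intro allI tensor_lift_param F t multilinearD[OF F(2)])
  show ?thesis
    using s
  proof (induction rule: tensor_algebra_induct)
    case zero
    show ?case
      using multilinear_vs[OF F(1)] multilinear_vs[OF F(2)] t
      by (simp add: linearD(5)[OF tensor_lift_linear[OF m1]]
          linearD(5)[OF tensor_lift_linear[OF F(2)]] tensor_lift_zero)
  next
    case (step c vs y)
    have m2: "multilinear sW sX (\<lambda>ws. tensor_lift sV sX (\<lambda>vs. F vs ws) y)"
      unfolding multilinear_def
      by (intro allI tensor_lift_param F step.hyps multilinearD[OF F(1)])
    show ?case
      by (simp only: linearD[OF tensor_lift_linear[OF m1]] tensor_lift_tens[OF m1]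
          linearD[OF tensor_lift_linear[OF F(2)]] tensor_lift_tens[OF F(2)]
          tensor_lift_add[OF multilinear_scale[OF F(1)] m2 t] tensor_lift_scale[OF F(1) t] step.IH)
  qed
qed

subsection \<open>Multiplication in the tensor algebra\<close>

locale tensor_space = vector_space sV
  for sV :: "'k::field \<Rightarrow> 'v::ab_group_add \<Rightarrow> 'v"
begin

abbreviation "T \<equiv> tensor_algebra sV"
abbreviation "tm \<equiv> tensor_mult sV"

lemma vs: "vector_space sV"
  by unfold_locales

lemma tens_linear: "Vector_Spaces.linear sV tensor_scale (\<lambda>v. tens sV (us @ v # ws))"
proof (rule linearI'[OF vs vector_space_tensor_scale])
  show "tens sV (us @ (x + y) # ws) = tens sV (us @ x # ws) + tens sV (us @ y # ws)" for x y
  proof (transfer fixing: sV us ws x y, rule ext)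
    fix \<phi> :: "'v list \<Rightarrow> 'k"
    show "(if multilinear sV (*) \<phi> then \<phi> (us @ (x + y) # ws) else 0) =
      (if multilinear sV (*) \<phi> then \<phi> (us @ x # ws) else 0) +
      (if multilinear sV (*) \<phi> then \<phi> (us @ y # ws) else 0)"
      using linearD(3)[OF multilinearD[of sV "(*)" \<phi> us ws], of x y] by simp
  qed
  show "tens sV (us @ sV c x # ws) = tensor_scale c (tens sV (us @ x # ws))" for c x
  proof (transfer fixing: sV us ws c x, rule ext)
    fix \<phi> :: "'v list \<Rightarrow> 'k"
    show "(if multilinear sV (*) \<phi> then \<phi> (us @ sV c x # ws) else 0) =
      c * (if multilinear sV (*) \<phi> then \<phi> (us @ x # ws) else 0)"
      using linearD(4)[OF multilinearD[of sV "(*)" \<phi> us ws], of c x] by simp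
  qed
qed

lemma tens_multilinear: "multilinear sV tensor_scale (tens sV)"
  by (simp add: multilinear_def tens_linear)

lemma append_multilinear:
  "multilinear sV tensor_scale (\<lambda>us. tens sV (us @ ws))"
  "multilinear sV tensor_scale (\<lambda>ws. tens sV (us @ ws))"
  using tens_linear[of _ "_ @ ws"] tens_linear[of "us @ _" ] by (simp_all add: multilinear_def)

lemma tm_inner_multilinear:
  assumes "y \<in> T"
  shows "multilinear sV tensor_scale (\<lambda>us. tensor_lift sV tensor_scale (\<lambda>ws. tens sV (us @ ws)) y)"
  unfolding multilinear_def
  by (intro allI tensor_lift_param append_multilinear assms multilinearD[OF append_multilinear(1)])

lemma tm_linear1: "y \<in> T \<Longrightarrow> Vector_Spaces.linear tensor_scale tensor_scale (\<lambda>x. tm x y)"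
  unfolding tensor_mult_def by (intro tensor_lift_linear tm_inner_multilinear)

lemma tm_tens: "y \<in> T \<Longrightarrow> tm (tens sV us) y = tensor_lift sV tensor_scale (\<lambda>ws. tens sV (us @ ws)) y"
  by (simp add: tensor_mult_def tensor_lift_tens tm_inner_multilinear)

lemma tm_tens_tens [simp]: "tm (tens sV us) (tens sV ws) = tens sV (us @ ws)"
  by (simp add: tm_tens tens_in tensor_lift_tens append_multilinear)

lemma tm_swap:
  assumes "x \<in> T" "y \<in> T"
  shows "tm x y = tensor_lift sV tensor_scale (\<lambda>ws. tm x (tens sV ws)) y"
  unfolding tensor_mult_def
  by (subst tensor_lift_fubini) (simp_all add: append_multilinear assms tensor_lift_tens)

lemma tm_tens_multilinear:
  assumes "x \<in> T"
  shows "multilinear sV tensor_scale (\<lambda>ws. tm x (tens sV ws))"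
proof -
  have "multilinear sV tensor_scale (\<lambda>ws. tensor_lift sV tensor_scale (\<lambda>us. tens sV (us @ ws)) x)"
    unfolding multilinear_def
    by (intro allI tensor_lift_param append_multilinear assms multilinearD[OF append_multilinear(2)])
  then show ?thesis
    by (simp add: tensor_mult_def tensor_lift_tens append_multilinear)
qed

lemma tm_linear2:
  assumes "x \<in> T"
  obtains L where "Vector_Spaces.linear tensor_scale tensor_scale L" "\<And>y. y \<in> T \<Longrightarrow> tm x y = L y"
  using tensor_lift_linear[OF tm_tens_multilinear[OF assms]] tm_swap[OF assms] by blast

lemma tm_add_left: "z \<in> T \<Longrightarrow> tm (x + y) z = tm x z + tm y z"
  and tm_scale_left: "z \<in> T \<Longrightarrow> tm (tensor_scale c x) z = tensor_scale c (tm x z)"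
  and tm_zero_left: "z \<in> T \<Longrightarrow> tm 0 z = 0"
  using linearD[OF tm_linear1] by auto

lemma tm_add_right: "x \<in> T \<Longrightarrow> y \<in> T \<Longrightarrow> z \<in> T \<Longrightarrow> tm x (y + z) = tm x y + tm x z"
  by (rule tm_linear2[of x], assumption, drule linearD(3)[where x = y and y = z])
    (simp add: tensor_algebra_add)

lemma tm_scale_right: "x \<in> T \<Longrightarrow> y \<in> T \<Longrightarrow> tm x (tensor_scale c y) = tensor_scale c (tm x y)"
  by (rule tm_linear2[of x], assumption, drule linearD(4)[where x = y and c = c])
    (simp add: tensor_algebra_scale)

lemma tm_zero_right: "x \<in> T \<Longrightarrow> tm x 0 = 0"
  by (rule tm_linear2[of x], assumption, drule linearD(5)) (simp add: tensor_algebra_zero)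

lemma tm_closed: "x \<in> T \<Longrightarrow> y \<in> T \<Longrightarrow> tm x y \<in> T"
proof (induction rule: tensor_algebra_induct)
  case zero
  then show ?case by (simp add: tm_zero_left tensor_algebra_zero)
next
  case (step c vs x)
  from step.prems have "tm (tens sV vs) y \<in> T"
    by (induction rule: tensor_algebra_induct)
      (simp_all add: tm_zero_right tm_add_right tm_scale_right tens_in tensor_algebra_zero
        tensor_algebra_add tensor_algebra_scale)
  with step show ?case
    by (simp add: tm_add_left tm_scale_left tensor_algebra_add tensor_algebra_scale)
qed

lemma tm_assoc:
  assumes "x \<in> T" "y \<in> T" "z \<in> T"
  shows "tm (tm x y) z = tm x (tm y z)"
  using assms(1)
proof (induction rule: tensor_algebra_induct)
  case zero
  then show ?case using assms by (simp add: tm_zero_left tm_closed)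
next
  case (step c us x)
  have "tm (tm (tens sV us) y) z = tm (tens sV us) (tm y z)"
    using assms(2)
  proof (induction rule: tensor_algebra_induct)
    case zero
    then show ?case using assms by (simp add: tm_zero_left tm_zero_right tens_in)
  next
    case (step c vs y)
    have "tm (tens sV (us @ vs)) z = tm (tens sV us) (tm (tens sV vs) z)"
      using assms(3)
      by (induction rule: tensor_algebra_induct)
        (simp_all add: tm_zero_right tm_add_right tm_scale_right tens_in tm_closed
          tensor_algebra_scale)
    with step assms show ?case
      by (simp add: tm_add_left tm_scale_left tm_add_right tm_scale_right tens_in tm_closed
          tensor_algebra_scale tensor_algebra_add)
  qed
  with step assms show ?case
    by (simp add: tm_add_left tm_scale_left tens_in tm_closed
        tensor_algebra_scale tensor_algebra_add)
qed

lemma tm_unit_left: "x \<in> T \<Longrightarrow> tm (tens sV []) x = x"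
  by (induction rule: tensor_algebra_induct)
    (simp_all add: tm_zero_right tm_add_right tm_scale_right tens_in tensor_algebra_scale)

lemma tm_unit_right: "x \<in> T \<Longrightarrow> tm x (tens sV []) = x"
  by (induction rule: tensor_algebra_induct)
    (simp_all add: tm_zero_left tm_add_left tm_scale_left tens_in)

lemma tensor_algebra_algebra: "algebra_on tensor_scale T tm (tens sV [])"
  unfolding algebra_on_def algebra_on_axioms_def
  by (simp add: vector_space_tensor_scale tensor_algebra_subspace tm_closed tens_in tm_add_left
      tm_add_right tm_scale_left tm_scale_right tm_assoc tm_unit_left tm_unit_right)

end

subsection \<open>Sweedler calculus\<close>

definition bilin ::
    "('k::field \<Rightarrow> 'h::ab_group_add \<Rightarrow> 'h) \<Rightarrow> ('k \<Rightarrow> 'x::ab_group_add \<Rightarrow> 'x) \<Rightarrow> ('h \<Rightarrow> 'h \<Rightarrow> 'x) \<Rightarrow> bool"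
  where "bilin sH sX f \<longleftrightarrow> (\<forall>b. Vector_Spaces.linear sH sX (\<lambda>a. f a b)) \<and>
    (\<forall>a. Vector_Spaces.linear sH sX (f a))"

lemma bilinI:
  "(\<And>b. Vector_Spaces.linear sH sX (\<lambda>a. f a b)) \<Longrightarrow> (\<And>a. Vector_Spaces.linear sH sX (\<lambda>b. f a b)) \<Longrightarrow>
    bilin sH sX f"
  by (simp add: bilin_def)

lemma bilinD:
  assumes "bilin sH sX f"
  shows "Vector_Spaces.linear sH sX (\<lambda>a. f a b)" "Vector_Spaces.linear sH sX (\<lambda>b. f a b)"
  using assms by (simp_all add: bilin_def)

lemma bilinear_family_simp [simp]: "bilinear_family f [a, b] = f a b"
  by (simp add: bilinear_family_def)

lemma bilinear_family_cases:
  obtains a b where "hs = [a, b]" | "length hs \<noteq> 2"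
  by (cases "length hs = 2") (auto simp: numeral_2_eq_2 length_Suc_conv)

lemma bilinear_family_zero [simp]: "length hs \<noteq> 2 \<Longrightarrow> bilinear_family f hs = 0"
  by (auto simp: bilinear_family_def split: list.splits)

lemma bilinear_family_linear:
  assumes "vector_space sP" "vector_space sX"
    and "\<And>a b. Vector_Spaces.linear sP sX (\<lambda>p. f p a b)"
  shows "Vector_Spaces.linear sP sX (\<lambda>p. bilinear_family (f p) hs)"
  by (rule bilinear_family_cases[of hs]) (simp_all add: assms linear_zero')

lemma bilinear_family_multilinear:
  fixes sH :: "'k::field \<Rightarrow> 'h::ab_group_add \<Rightarrow> 'h"
  assumes "bilin sH sX f"
  shows "multilinear sH sX (bilinear_family f)"
  unfolding multilinear_def
proof (intro allI)
  fix us ws :: "'h list"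
  note l = bilinD[OF assms]
  note z = linear_zero'[OF linearD(1,2)[OF l(1)]]
  consider "us = []" "length ws = 1" | "length us = 1" "ws = []" | "length us + length ws \<noteq> 1"
    by (cases us; cases ws; auto)
  then show "Vector_Spaces.linear sH sX (\<lambda>v. bilinear_family f (us @ v # ws))"
  proof cases
    case 1
    then show ?thesis using l by (auto simp: bilinear_family_def length_Suc_conv)
  next
    case 2
    then show ?thesis using l by (auto simp: bilinear_family_def length_Suc_conv)
  next
    case 3
    then have "(\<lambda>v. bilinear_family f (us @ v # ws)) = (\<lambda>v. 0)"
      by (intro ext bilinear_family_zero) simp
    then show ?thesis using z by simp
  qed
qed

lemma bilinear_family_compose:
  "L 0 = 0 \<Longrightarrow> L (bilinear_family f hs) = bilinear_family (\<lambda>a b. L (f a b)) hs"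
  by (rule bilinear_family_cases[of hs]) simp_all

context hopf_algebra
begin

abbreviation sw where "sw \<equiv> sweedler sH \<Delta>"

lemma vsH: "vector_space sH"
  by unfold_locales

lemma comult_in_algebra: "\<Delta> h \<in> tensor_algebra sH"
  using comult_in tensor_power_subset by blast

lemma sw_linear:
  assumes "bilin sH sX f"
  shows "Vector_Spaces.linear sH sX (sw sX f)"
  using linear_compose'[OF tensor_lift_linear[OF bilinear_family_multilinear[OF assms]] comult_linear]
  by (simp add: sweedler_def[abs_def])

lemma sw_compose:
  assumes "bilin sH sX f" "Vector_Spaces.linear sX sY L"
  shows "L (sw sX f h) = sw sY (\<lambda>a b. L (f a b)) h"
  unfolding sweedler_def
  by (subst tensor_lift_compose[OF bilinear_family_multilinear[OF assms(1)] assms(2) comult_in_algebra])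
    (simp add: bilinear_family_compose linearD(5)[OF assms(2)])

lemma sw_param:
  assumes "\<And>p. bilin sH sX (f p)" "\<And>a b. Vector_Spaces.linear sP sX (\<lambda>p. f p a b)"
  shows "Vector_Spaces.linear sP sX (\<lambda>p. sw sX (f p) h)"
  unfolding sweedler_def
  by (rule tensor_lift_param)
    (use assms linearD(1,2)[OF assms(2)] in
      \<open>simp_all add: bilinear_family_multilinear bilinear_family_linear comult_in_algebra\<close>)

lemma sw_one: "bilin sH sX f \<Longrightarrow> sw sX f 1 = f 1 1"
  by (simp add: sweedler_def comult_one tensor_lift_tens bilinear_family_multilinear)
   

lemma sw_closed:
  assumes "bilin sH sX f" "module.subspace sX A" "\<And>a b. f a b \<in> A"
  shows "sw sX f h \<in> A"
  unfolding sweedler_def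
proof (rule tensor_lift_closed[OF bilinear_family_multilinear[OF assms(1)] assms(2) _ comult_in_algebra])
  have "module sX"
    using linearD(2)[OF bilinD(1)[OF assms(1)]] by (simp add: module_iff_vector_space)
  then show "bilinear_family f vs \<in> A" for vs
    using assms(2,3) by (cases rule: bilinear_family_cases[of vs]) (simp_all add: module.subspace_0)
qed

lemma sw_counit_left:
  assumes "Vector_Spaces.linear sH sX f"
  shows "sw sX (\<lambda>a b. sX (\<epsilon> a) (f b)) h = f h"
proof -
  have b: "bilin sH sH (\<lambda>a b. sH (\<epsilon> a) b)"
    by (intro bilinI linear_scale_left' counit_linear linear_scale' vsH)
      (simp add: linear_ident)
  show ?thesis
    using sw_compose[OF b assms, of h] by (simp add: counit_left linearD[OF assms])
qed

lemma sw_counit_right: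
  assumes "Vector_Spaces.linear sH sX f"
  shows "sw sX (\<lambda>a b. sX (\<epsilon> b) (f a)) h = f h"
proof -
  have b: "bilin sH sH (\<lambda>a b. sH (\<epsilon> b) a)"
    by (intro bilinI linear_scale_left' counit_linear linear_scale' vsH)
      (simp add: linear_ident)
  show ?thesis
    using sw_compose[OF b assms, of h] by (simp add: counit_right linearD[OF assms])
qed

lemma mult_linear: "Vector_Spaces.linear sH sH (\<lambda>a. a * b)" "Vector_Spaces.linear sH sH (\<lambda>b. a * b)"
  by (rule linearI'; simp add: vsH algebra_simps scale_mult_left scale_mult_right)+

lemma tens2_linear:
  "Vector_Spaces.linear sH tensor_scale (\<lambda>a. tens sH [a, b])"
  "Vector_Spaces.linear sH tensor_scale (\<lambda>b. tens sH [a, b])"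
  using multilinearD[OF tensor_space.tens_multilinear[of sH], of "[]" "[b]"]
    multilinearD[OF tensor_space.tens_multilinear[of sH], of "[a]" "[]"] vsH
  by (simp_all add: tensor_space_def)

lemma tens3_linear:
  "Vector_Spaces.linear sH tensor_scale (\<lambda>a. tens sH [a, b, c])"
  "Vector_Spaces.linear sH tensor_scale (\<lambda>b. tens sH [a, b, c])"
  "Vector_Spaces.linear sH tensor_scale (\<lambda>c. tens sH [a, b, c])"
  using multilinearD[OF tensor_space.tens_multilinear[of sH], of "[]" "[b, c]"]
    multilinearD[OF tensor_space.tens_multilinear[of sH], of "[a]" "[c]"]
    multilinearD[OF tensor_space.tens_multilinear[of sH], of "[a, b]" "[]"] vsH
  by (simp_all add: tensor_space_def)

lemma sw_mult:
  assumes f: "bilin sH sX f"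
  shows "sw sX f (g * h) = sw sX (\<lambda>a b. sw sX (\<lambda>c d. f (a * c) (b * d)) h) g"
proof -
  let ?L = "tensor_lift sH sX (bilinear_family f)"
  note m = bilinear_family_multilinear[OF f]
  note L = tensor_lift_linear[OF m]
  have b1: "bilin sH tensor_scale (\<lambda>c d. tens sH [a * c, b * d])" for a b
    by (intro bilinI linear_compose'[OF tens2_linear(1) mult_linear(2)]
        linear_compose'[OF tens2_linear(2) mult_linear(2)])
  have b2: "bilin sH tensor_scale (\<lambda>a b. sw tensor_scale (\<lambda>c d. tens sH [a * c, b * d]) h)"
    by (intro bilinI sw_param b1 linear_compose'[OF tens2_linear(1) mult_linear(1)]
        linear_compose'[OF tens2_linear(2) mult_linear(1)])
  have "sw sX f (g * h) = ?L (\<Delta> (g * h))"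
    by (simp add: sweedler_def)
  also have "\<dots> = sw sX (\<lambda>a b. sw sX (\<lambda>c d. ?L (tens sH [a * c, b * d])) h) g"
    unfolding comult_mult sw_compose[OF b2 L] sw_compose[OF b1 L] ..
  finally show ?thesis
    by (simp add: tensor_lift_tens[OF m])
qed

definition trilinear_family :: "('h \<Rightarrow> 'h \<Rightarrow> 'h \<Rightarrow> 'x::zero) \<Rightarrow> 'h list \<Rightarrow> 'x"
  where "trilinear_family f hs = (case hs of [a, b, c] \<Rightarrow> f a b c | _ \<Rightarrow> 0)"

lemma trilinear_family_zero: "length hs \<noteq> 3 \<Longrightarrow> trilinear_family f hs = 0"
  by (auto simp: trilinear_family_def split: list.splits)

lemma trilinear_family_multilinear:
  assumes "\<And>b c. Vector_Spaces.linear sH sX (\<lambda>a. f a b c)"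
    "\<And>a c. Vector_Spaces.linear sH sX (\<lambda>b. f a b c)"
    "\<And>a b. Vector_Spaces.linear sH sX (\<lambda>c. f a b c)"
  shows "multilinear sH sX (trilinear_family f)"
  unfolding multilinear_def
proof (intro allI)
  fix us ws :: "'h list"
  note z = linear_zero'[OF linearD(1,2)[OF assms(1)]]
  consider "us = []" "length ws = 2" | "length us = 1" "length ws = 1" | "length us = 2" "ws = []"
    | "length us + length ws \<noteq> 2"
  proof -
    have "length us + length ws = 2 \<longleftrightarrow>
      us = [] \<and> length ws = 2 \<or> length us = 1 \<and> length ws = 1 \<or> length us = 2 \<and> ws = []"
      unfolding length_0_conv[symmetric] by linarith
    then show ?thesis using that by blast
  qed
  then show "Vector_Spaces.linear sH sX (\<lambda>v. trilinear_family f (us @ v # ws))"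
  proof cases
    case 4
    then have "(\<lambda>v. trilinear_family f (us @ v # ws)) = (\<lambda>v. 0)"
      by (intro ext trilinear_family_zero) simp
    then show ?thesis using z by simp
  qed (auto simp: trilinear_family_def length_Suc_conv numeral_2_eq_2 assms)
qed

lemma sw_coassoc:
  assumes f: "\<And>b c. Vector_Spaces.linear sH sX (\<lambda>a. f a b c)"
    "\<And>a c. Vector_Spaces.linear sH sX (\<lambda>b. f a b c)"
    "\<And>a b. Vector_Spaces.linear sH sX (\<lambda>c. f a b c)"
  shows "sw sX (\<lambda>a b. sw sX (\<lambda>a1 a2. f a1 a2 b) a) h = sw sX (\<lambda>a b. sw sX (\<lambda>b1 b2. f a b1 b2) b) h"
proof -
  let ?L = "tensor_lift sH sX (trilinear_family f)"
  note m = trilinear_family_multilinear[OF f]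
  note L = tensor_lift_linear[OF m]
  have b1: "bilin sH tensor_scale (\<lambda>a b. tens sH [a, b, c])"
    "bilin sH tensor_scale (\<lambda>b c. tens sH [a, b, c])" for a c
    by (intro bilinI tens3_linear)+
  have b2: "bilin sH tensor_scale (\<lambda>a b. sw tensor_scale (\<lambda>a1 a2. tens sH [a1, a2, b]) a)"
    "bilin sH tensor_scale (\<lambda>a b. sw tensor_scale (\<lambda>b1 b2. tens sH [a, b1, b2]) b)"
    by (intro bilinI sw_linear sw_param b1 tens3_linear)+
  have "sw sX (\<lambda>a b. sw sX (\<lambda>a1 a2. ?L (tens sH [a1, a2, b])) a) h =
    sw sX (\<lambda>a b. sw sX (\<lambda>b1 b2. ?L (tens sH [a, b1, b2])) b) h"
    using arg_cong[OF coassoc[of h], of ?L]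
    unfolding sw_compose[OF b2(1) L] sw_compose[OF b2(2) L] sw_compose[OF b1(1) L]
      sw_compose[OF b1(2) L] .
  then show ?thesis
    by (simp add: tensor_lift_tens[OF m]) (simp add: trilinear_family_def)
qed

lemma bilinear_family_commute:
  "bilinear_family (\<lambda>a b. bilinear_family (F a b) ks) hs =
   bilinear_family (\<lambda>c d. bilinear_family (\<lambda>a b. F a b c d) hs) ks"
  by (rule bilinear_family_cases[of hs]; rule bilinear_family_cases[of ks]) simp_all

lemma sw_lift_fubini:
  assumes F: "\<And>c d. bilin sH sX (\<lambda>a b. F a b c d)" "\<And>a b. bilin sH sX (\<lambda>c d. F a b c d)"
  shows "sw sX (\<lambda>a b. sw sX (\<lambda>c d. F a b c d) h) g = sw sX (\<lambda>c d. sw sX (\<lambda>a b. F a b c d) g) h"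
proof -
  let ?G = "\<lambda>hs ks. bilinear_family (\<lambda>a b. bilinear_family (F a b) ks) hs"
  have vX: "vector_space sX" using linearD(2)[OF bilinD(1)[OF F(1)]] .
  have m1: "multilinear sH sX (\<lambda>hs. ?G hs ks)" for ks
    by (intro bilinear_family_multilinear bilinI bilinear_family_linear vsH vX bilinD[OF F(1)])
  have m2: "multilinear sH sX (?G hs)" for hs
    unfolding bilinear_family_commute[of F]
    by (intro bilinear_family_multilinear bilinI bilinear_family_linear vsH vX bilinD[OF F(2)])
  note z = tensor_lift_zero[OF vsH vX comult_in_algebra]
  have "sw sX (\<lambda>a b. sw sX (\<lambda>c d. F a b c d) h) g =
    tensor_lift sH sX (\<lambda>hs. tensor_lift sH sX (?G hs) (\<Delta> h)) (\<Delta> g)"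
    unfolding sweedler_def
    by (intro arg_cong[where f = "\<lambda>f. tensor_lift sH sX f _"] ext)
      (case_tac hs rule: bilinear_family_cases, simp_all add: z)
  also have "\<dots> = tensor_lift sH sX (\<lambda>ks. tensor_lift sH sX (\<lambda>hs. ?G hs ks) (\<Delta> g)) (\<Delta> h)"
    by (rule tensor_lift_fubini[OF m2 m1 comult_in_algebra comult_in_algebra])
  also have "\<dots> = sw sX (\<lambda>c d. sw sX (\<lambda>a b. F a b c d) g) h"
    unfolding sweedler_def bilinear_family_commute[of F]
    by (intro arg_cong[where f = "\<lambda>f. tensor_lift sH sX f _"] ext)
      (case_tac ks rule: bilinear_family_cases, simp_all add: z)
  finally show ?thesis .
qed

end

subsection \<open>The action induced by a module\<close>

locale hopf_module = hopf_algebra sH \<Delta> \<epsilon> S + V: algebra_module sH sV UNIV \<rho> + TV: tensor_space sV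
  for sH :: "'k::field \<Rightarrow> 'h::ring_1 \<Rightarrow> 'h" and \<Delta> \<epsilon> S
    and sV :: "'k \<Rightarrow> 'v::ab_group_add \<Rightarrow> 'v" and \<rho>
begin

abbreviation "T \<equiv> tensor_algebra sV"
abbreviation "tm \<equiv> tensor_mult sV"
abbreviation "D \<equiv> diagonal_action sH \<Delta> \<epsilon> sV \<rho>"

lemma rho_linear: "Vector_Spaces.linear sH sV (\<lambda>a. \<rho> a v)" "Vector_Spaces.linear sV sV (\<rho> a)"
  by (rule linearI'; simp add: vsH TV.vs V.act_add_left V.act_scale_left V.act_add_right
      V.act_scale_right)+

lemma single_linear: "Vector_Spaces.linear sV tensor_scale (\<lambda>v. tens sV [v])"
  using TV.tens_linear[of "[]" "[]"] by simp

lemma tm_linear_left: "y \<in> T \<Longrightarrow> Vector_Spaces.linear sP tensor_scale g \<Longrightarrow>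
    Vector_Spaces.linear sP tensor_scale (\<lambda>p. tm (g p) y)"
  by (rule linear_compose'[OF TV.tm_linear1])

lemma tm_linear_right:
  assumes "x \<in> T" "Vector_Spaces.linear sP tensor_scale g" "\<And>p. g p \<in> T"
  shows "Vector_Spaces.linear sP tensor_scale (\<lambda>p. tm x (g p))"
  by (rule TV.tm_linear2[OF assms(1)]) (simp add: assms linear_compose'[OF _ assms(2)])

lemma D_in: "D vs h \<in> T" and D_linear: "Vector_Spaces.linear sH tensor_scale (D vs)"
proof (induction vs arbitrary: h)
  case Nil
  {
    case 1
    show ?case by (simp add: tens_in tensor_algebra_scale)
  next
    case 2
    show ?case
      by (simp add: linear_scale_left'[OF counit_linear vector_space_tensor_scale])
  }
next
  case (Cons v vs)
  have b: "bilin sH tensor_scale (\<lambda>a b. tm (tens sV [\<rho> a v]) (D vs b))"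
    by (intro bilinI tm_linear_left tm_linear_right Cons.IH tens_in
        linear_compose'[OF single_linear rho_linear(1)])
  {
    case 1
    show ?case
      by (simp add: sw_closed[OF b tensor_algebra_subspace] TV.tm_closed tens_in Cons.IH)
  next
    case 2
    show ?case by (simp add: sw_linear[OF b])
  }
qed

lemma D_bilin: "bilin sH tensor_scale (\<lambda>a b. tm (tens sV [\<rho> a v]) (D vs b))"
  by (intro bilinI tm_linear_left tm_linear_right D_in D_linear tens_in
      linear_compose'[OF single_linear rho_linear(1)])

lemma D_multilinear: "multilinear sV tensor_scale (\<lambda>vs. D vs h)"
proof -
  have "Vector_Spaces.linear sV tensor_scale (\<lambda>v. D (us @ v # ws) h)" for us ws
  proof (induction us arbitrary: h)
    case Nil
    show ?case
      by simp (intro sw_param D_bilin tm_linear_left D_in linear_compose'[OF single_linear rho_linear(2)])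
  next
    case (Cons u us)
    show ?case
      by simp (intro sw_param D_bilin tm_linear_right D_in Cons.IH tens_in)
  qed
  then show ?thesis by (simp add: multilinear_def)
qed

definition induced :: "'h \<Rightarrow> ('v, 'k) tensor \<Rightarrow> ('v, 'k) tensor"
  where "induced h = tensor_lift sV tensor_scale (\<lambda>vs. D vs h)"

lemma induced_tens [simp]: "induced h (tens sV vs) = D vs h"
  by (simp add: induced_def tensor_lift_tens D_multilinear)

lemma induced_linear: "Vector_Spaces.linear tensor_scale tensor_scale (induced h)"
  by (simp add: induced_def tensor_lift_linear D_multilinear)

lemma induced_in: "x \<in> T \<Longrightarrow> induced h x \<in> T"
  by (simp add: induced_def tensor_lift_closed D_multilinear tensor_algebra_subspace D_in)

lemma induced_linear_left: "x \<in> T \<Longrightarrow> Vector_Spaces.linear sH tensor_scale (\<lambda>h. induced h x)"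
  by (simp add: induced_def tensor_lift_param D_multilinear D_linear)

lemma induced_bilin:
  assumes "x \<in> T" "y \<in> T"
  shows "bilin sH tensor_scale (\<lambda>a b. tm (induced a x) (induced b y))"
  by (intro bilinI tm_linear_left tm_linear_right induced_linear_left induced_in assms)

lemma induced_mult_tens: "D (us @ ws) h = sw tensor_scale (\<lambda>a b. tm (D us a) (D ws b)) h"
proof (induction us arbitrary: h)
  case Nil
  show ?case
    by (simp add: TV.tm_scale_left D_in TV.tm_unit_left sw_counit_left D_linear)
next
  case (Cons u us)
  have bi: "bilin sH tensor_scale (\<lambda>a b. tm (D us a) (D ws b))"
    by (intro bilinI tm_linear_left tm_linear_right D_in D_linear)
  have swT: "sw tensor_scale (\<lambda>a b. tm (D us a) (D ws b)) b \<in> T" for b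
    by (rule sw_closed[OF bi tensor_algebra_subspace]) (simp add: TV.tm_closed D_in)
  have dist: "tm (tens sV [v]) (sw tensor_scale (\<lambda>a b. tm (D us a) (D ws b)) h) =
      sw tensor_scale (\<lambda>a b. tm (tens sV [v]) (tm (D us a) (D ws b))) h" for v h
    by (rule TV.tm_linear2[OF tens_in[of sV "[v]"]])
      (simp add: swT sw_compose[OF bi] TV.tm_closed D_in)
  have distr: "tm (D (u # us) a) (D ws b) =
      sw tensor_scale (\<lambda>a1 a2. tm (tm (tens sV [\<rho> a1 u]) (D us a2)) (D ws b)) a" for a b
    using sw_compose[OF D_bilin TV.tm_linear1[OF D_in]] by simp
  have "D ((u # us) @ ws) h =
      sw tensor_scale (\<lambda>a b. sw tensor_scale
        (\<lambda>b1 b2. tm (tens sV [\<rho> a u]) (tm (D us b1) (D ws b2))) b) h"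
    by (simp add: Cons.IH dist)
  also have "\<dots> = sw tensor_scale (\<lambda>a b. sw tensor_scale
        (\<lambda>a1 a2. tm (tens sV [\<rho> a1 u]) (tm (D us a2) (D ws b))) a) h"
    by (rule sw_coassoc[symmetric])
      (intro tm_linear_left tm_linear_right D_in D_linear tens_in TV.tm_closed
        linear_compose'[OF single_linear rho_linear(1)])+
  also have "\<dots> = sw tensor_scale (\<lambda>a b. tm (D (u # us) a) (D ws b)) h"
    by (simp only: distr TV.tm_assoc[OF tens_in D_in D_in])
  finally show ?case .
qed

lemma sw_lift:
  assumes F: "\<And>a b. multilinear sV sX (\<lambda>vs. F vs a b)" "\<And>vs. bilin sH sX (F vs)" and t: "t \<in> T"
  shows "sw sX (\<lambda>a b. tensor_lift sV sX (\<lambda>vs. F vs a b) t) h = tensor_lift sV sX (\<lambda>vs. sw sX (F vs) h) t"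
proof -
  have vX: "vector_space sX" using multilinear_vs[OF F(1)] by simp
  have m1: "multilinear sV sX (\<lambda>vs. bilinear_family (F vs) hs)" for hs
    unfolding multilinear_def
    by (intro allI bilinear_family_linear TV.vs vX multilinearD[OF F(1)])
  have "bilinear_family (\<lambda>a b. tensor_lift sV sX (\<lambda>vs. F vs a b) t) hs =
      tensor_lift sV sX (\<lambda>vs. bilinear_family (F vs) hs) t" for hs
    by (cases rule: bilinear_family_cases[of hs]) (simp_all add: tensor_lift_zero[OF TV.vs vX t])
  then show ?thesis
    unfolding sweedler_def
      tensor_lift_fubini[OF bilinear_family_multilinear[OF F(2)] m1 t comult_in_algebra]
    by (intro arg_cong[where f = "\<lambda>f. tensor_lift sH sX f _"] ext)
qed

lemma induced_mult:
  assumes x: "x \<in> T" and y: "y \<in> T"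
  shows "induced h (tm x y) = sw tensor_scale (\<lambda>a b. tm (induced a x) (induced b y)) h"
proof -
  have lin: "Vector_Spaces.linear sV tensor_scale (\<lambda>v. D (us @ v # ws) a)" for us ws a
    by (rule multilinearD[OF D_multilinear])
  have bD: "bilin sH tensor_scale (\<lambda>a b. tm (D us a) (D ws b))" for us ws
    by (intro bilinI tm_linear_left tm_linear_right D_in D_linear)
  have m1: "multilinear sV tensor_scale (\<lambda>ws. tm (D us a) (D ws b))" for us a b
    unfolding multilinear_def by (intro allI tm_linear_right lin D_in)
  have m2: "multilinear sV tensor_scale (\<lambda>us. tm (D us a) (induced b y))" for a b
    unfolding multilinear_def by (intro allI tm_linear_left lin induced_in y)
  have "tm (D us a) (induced b y) = tensor_lift sV tensor_scale (\<lambda>ws. tm (D us a) (D ws b)) y"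
    for us a b
  proof (rule TV.tm_linear2[OF D_in[of us a]])
    fix L
    assume L: "Vector_Spaces.linear tensor_scale tensor_scale L"
      "\<And>y. y \<in> T \<Longrightarrow> tm (D us a) y = L y"
    show ?thesis
      using tensor_lift_compose[OF D_multilinear L(1) y]
      by (simp add: L(2) induced_in y D_in flip: induced_def)
  qed
  then have 1: "induced h (tm (tens sV us) y) = sw tensor_scale (\<lambda>a b. tm (D us a) (induced b y)) h" for us
    using sw_lift[OF m1 bD y] tensor_lift_compose[OF TV.append_multilinear(2) induced_linear y]
    by (simp add: TV.tm_tens y induced_mult_tens)
  have "tm (induced a x) (induced b y) = tensor_lift sV tensor_scale (\<lambda>us. tm (D us a) (induced b y)) x"
    for a b
    unfolding induced_def[of a]
    by (rule tensor_lift_compose[OF D_multilinear TV.tm_linear1[OF induced_in[OF y]] x])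
  moreover have "bilin sH tensor_scale (\<lambda>a b. tm (D us a) (induced b y))" for us
    using induced_bilin[OF tens_in y] by simp
  ultimately have "sw tensor_scale (\<lambda>a b. tm (induced a x) (induced b y)) h =
      tensor_lift sV tensor_scale (\<lambda>us. induced h (tm (tens sV us) y)) x"
    using sw_lift[OF m2 _ x] by (simp add: 1)
  also have "\<dots> = induced h (tm x y)"
    by (simp only: TV.tm_tens[OF y] tensor_mult_def[of sV x y]
        tensor_lift_compose[OF TV.tm_inner_multilinear[OF y] induced_linear x])
  finally show ?thesis ..
qed

lemma induced_unit: "x \<in> T \<Longrightarrow> induced 1 x = x"
proof (rule tensor_linear_eqI[OF induced_linear])
  show "Vector_Spaces.linear tensor_scale tensor_scale (\<lambda>x :: ('v, 'k) tensor. x)"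
    by (rule linearI') (simp_all add: vector_space_tensor_scale)
  show "induced 1 (tens sV vs) = tens sV vs" for vs
    by (induction vs)
      (simp_all add: counit_one sw_one[OF D_bilin] V.act_one vector_space.vector_space_assms(4)
        vector_space_tensor_scale)
qed

lemma induced_act_mult_tens: "D vs (g * h) = induced g (D vs h)"
proof (induction vs arbitrary: g h)
  case Nil
  show ?case
    by (simp add: counit_mult linearD[OF induced_linear] vector_space.vector_space_assms(3)
        vector_space_tensor_scale mult.commute)
next
  case (Cons v vs)
  have b: "bilin sH tensor_scale (\<lambda>a b. tm (tens sV [\<rho> (a * c) v]) (D vs (b * d)))"
    "bilin sH tensor_scale (\<lambda>c d. tm (tens sV [\<rho> (a * c) v]) (D vs (b * d)))" for a b c d
    by (intro bilinI tm_linear_left tm_linear_right D_in linear_compose'[OF D_linear mult_linear(1)]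
        linear_compose'[OF D_linear mult_linear(2)] tens_in
        linear_compose'[OF single_linear linear_compose'[OF rho_linear(1) mult_linear(1)]]
        linear_compose'[OF single_linear linear_compose'[OF rho_linear(1) mult_linear(2)]])+
  have single: "D [u] g = tens sV [\<rho> g u]" for u g
    using sw_counit_right[OF linear_compose'[OF single_linear rho_linear(1)], of u g]
    by (simp add: TV.tm_scale_right tens_in)
  have "D (v # vs) (g * h) =
      sw tensor_scale (\<lambda>a b. sw tensor_scale (\<lambda>c d. tm (tens sV [\<rho> (a * c) v]) (D vs (b * d))) h) g"
    by (simp add: sw_mult[OF D_bilin])
  also have "\<dots> =
      sw tensor_scale (\<lambda>c d. sw tensor_scale (\<lambda>a b. tm (tens sV [\<rho> (a * c) v]) (D vs (b * d))) g) h"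
    by (rule sw_lift_fubini[OF b])
  also have "\<dots> = sw tensor_scale (\<lambda>c d. induced g (tm (tens sV [\<rho> c v]) (D vs d))) h"
    by (simp add: induced_mult tens_in D_in Cons.IH single V.act_mult del: diagonal_action.simps)
  also have "\<dots> = induced g (D (v # vs) h)"
    using sw_compose[OF D_bilin induced_linear] by simp
  finally show ?case .
qed

lemma induced_act_mult: "x \<in> T \<Longrightarrow> induced (g * h) x = induced g (induced h x)"
  by (rule tensor_linear_eqI[OF induced_linear linear_compose'[OF induced_linear induced_linear]])
    (simp_all add: induced_act_mult_tens)

lemma linear_action_induced: "linear_action sH \<Delta> \<epsilon> sV induced"
proof -
  have "algebra_module sH tensor_scale T induced"
    unfolding algebra_module_def algebra_module_axioms_def
    by (intro conjI allI impI k_algebra_axioms vector_space_tensor_scale tensor_algebra_subspace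
        linearD(3,4)[OF induced_linear] linearD(3,4)[OF induced_linear_left] induced_in induced_unit
        induced_act_mult)
  then have "module_algebra sH \<Delta> \<epsilon> tensor_scale T tm (tens sV []) induced"
    unfolding module_algebra_def module_algebra_axioms_def
    by (simp add: TV.tensor_algebra_algebra induced_mult)
  then show ?thesis
    unfolding linear_action_def using V.algebra_module_axioms by auto
qed

end

end

theory Submission
  imports Defs
begin

text \<open>
  A complement of the left ideal \<open>ker \<epsilon>\<close> yields \<open>\<Lambda>\<close> with \<open>h \<Lambda> = \<epsilon>(h) \<Lambda>\<close> and
  \<open>\<epsilon>(\<Lambda>) = 1\<close>. It acts on \<open>T(V)\<^sub>n\<close> as a projection onto the invariants, whose dimension is
  therefore the trace \<open>\<chi>\<^sup>n(\<Lambda>)\<close>, where \<open>\<chi>\<close> is the character of \<open>V\<close> and powers are taken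
  for the convolution product. By coassociativity, the \<open>n\<close>-fold iterate of
  \<open>h \<mapsto> \<Sum> \<chi>(h\<^sub>1) h\<^sub>2\<close> sends \<open>\<Lambda>\<close> to \<open>\<Sum> \<chi>\<^sup>n(\<Lambda>\<^sub>1) \<Lambda>\<^sub>2\<close>, so all iterates lie in the
  span of the finitely many right tensor factors of one expression for \<open>\<Delta> \<Lambda>\<close>. A linear
  dependence among the iterates is a linear recurrence for \<open>\<chi>\<^sup>n(\<Lambda>)\<close> over \<open>k\<close>. Applying to its
  coefficients a \<open>\<rat>\<close>-linear functional \<open>k \<rightarrow> \<rat>\<close> that does not kill all of them gives a
  recurrence over \<open>\<rat>\<close>.
\<close>

section \<open>Linear recurrences and rational power series\<close>

text \<open>Stated for a family rather than a set because the iterates it is applied to may repeat: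
  a repetition gives the relation with coefficients 1 and -1, and otherwise
  \<open>card Y + 1\<close> distinct vectors exceed the size of a spanning set.\<close>

lemma (in vector_space) finite_span_dependent_family:
  fixes w :: "nat \<Rightarrow> 'b"
  assumes "finite Y" and w: "\<And>i. w i \<in> span Y"
  obtains c where "\<exists>i\<le>card Y. c i \<noteq> 0" "(\<Sum>i\<le>card Y. scale (c i) (w i)) = 0"
proof (cases "inj_on w {..card Y}")
  case True
  have "dependent (w ` {..card Y})"
    using independent_span_bound[OF assms(1), of "w ` {..card Y}"] w card_image[OF True] by fastforce
  then obtain u where u: "\<exists>v\<in>w ` {..card Y}. u v \<noteq> 0" "(\<Sum>v\<in>w ` {..card Y}. scale (u v) v) = 0"
    by (auto simp: dependent_finite)
  show ?thesis
    by (rule that[of "\<lambda>i. u (w i)"]) (use u in \<open>auto simp: sum.reindex[OF True]\<close>)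
next
  case False
  then obtain i j where ij: "i \<le> card Y" "j \<le> card Y" "i \<noteq> j" "w i = w j"
    by (auto simp: inj_on_def)
  define c where "c = (\<lambda>l. if l = i then 1 else if l = j then - 1 else 0 :: 'a)"
  have "(\<Sum>l\<le>card Y. scale (c l) (w l)) = (\<Sum>l\<in>{i, j}. scale (c l) (w l))"
    by (rule sum.mono_neutral_right) (use ij in \<open>auto simp: c_def\<close>)
  also have "\<dots> = 0"
    using ij by (simp add: c_def)
  finally show ?thesis
    using ij by (intro that[of c]) (auto simp: c_def)
qed

lemma rational_recurrence:
  fixes c :: "nat \<Rightarrow> 'k::field_char_0" and a :: "nat \<Rightarrow> nat"
  assumes "c j \<noteq> 0" "j \<le> m" and rec: "\<And>n. (\<Sum>i\<le>m. c i * of_nat (a (i + n))) = 0"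
  obtains d :: "nat \<Rightarrow> rat" where "d j \<noteq> 0" "\<And>n. (\<Sum>i\<le>m. d i * of_nat (a (i + n))) = 0"
proof -
  let ?s = "\<lambda>(r :: rat) (x :: 'k). of_rat r * x"
  have vs: "vector_space ?s"
    by unfold_locales (simp_all add: algebra_simps of_rat_add of_rat_mult)
  \<comment> \<open>Over the rationals, linear functionals on \<open>'k\<close> separate points, so
    one of them is nonzero at \<open>c j\<close>. The values of \<open>a\<close> are rational
    scalars, hence pass through it.\<close>
  obtain \<xi> where \<xi>: "Vector_Spaces.linear ?s (*) \<xi>" "\<xi> (c j) \<noteq> \<xi> 0"
    using functional_separates[OF vs, of "c j" 0] assms(1) by blast
  have nat: "\<xi> (x * of_nat n) = \<xi> x * of_nat n" for x n
    using linearD(4)[OF \<xi>(1), of "of_nat n" x] by (simp add: mult.commute)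
  have sum: "\<xi> (\<Sum>i\<in>I. g i) = (\<Sum>i\<in>I. \<xi> (g i))" for I :: "nat set" and g
    by (induction I rule: infinite_finite_induct) (simp_all add: linearD[OF \<xi>(1)])
  have "(\<Sum>i\<le>m. \<xi> (c i) * of_nat (a (i + n))) = 0" for n
    using arg_cong[OF rec[of n], of \<xi>] by (simp add: sum nat linearD(5)[OF \<xi>(1)])
  then show ?thesis
    using \<xi>(2) by (intro that[of "\<lambda>i. \<xi> (c i)"]) (simp_all add: linearD(5)[OF \<xi>(1)])
qed

lemma linear_recurrence_rational:
  fixes a d :: "nat \<Rightarrow> 'a::field"
  assumes "d j \<noteq> 0" "j \<le> m" and rec: "\<And>n. (\<Sum>i\<le>m. d i * a (i + n)) = 0"
  shows "\<exists>p q. q \<noteq> 0 \<and> fps_of_poly q * Abs_fps a = fps_of_poly p"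
proof -
  \<comment> \<open>The coefficients are reversed, so that for \<open>n \<ge> m\<close> the
    coefficient of \<open>F\<close> at \<open>n\<close> is the recurrence started at
    \<open>n - m\<close>. The entry \<open>d j\<close> reappears in degree \<open>m - j\<close> and
    keeps \<open>q\<close> nonzero.\<close>
  define q where "q = (\<Sum>i\<le>m. monom (d (m - i)) i)"
  define F where "F = fps_of_poly q * Abs_fps a"
  have q: "coeff q i = (if i \<le> m then d (m - i) else 0)" for i
    by (simp add: q_def coeff_sum sum.delta)
  have "coeff q (m - j) = d j" using assms(2) by (simp add: q)
  then have "q \<noteq> 0" using assms(1) by auto
  have F: "fps_nth F n = 0" if "m \<le> n" for n
  proof -
    have "fps_nth F n = (\<Sum>i\<le>m. d (m - i) * a (n - i))"
      unfolding F_def fps_mult_nth using that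
      by (auto intro!: sum.mono_neutral_cong_right simp: q split: if_splits)
    also have "\<dots> = (\<Sum>i\<le>m. d i * a (i + (n - m)))"
      by (rule sum.reindex_bij_witness[of _ "\<lambda>i. m - i" "\<lambda>i. m - i"])
        (use that in \<open>auto simp: algebra_simps\<close>)
    finally show ?thesis using rec by simp
  qed
  \<comment> \<open>\<open>F\<close> vanishes from degree \<open>m\<close> on, so its first
    \<open>m\<close> coefficients form the numerator.\<close>
  have "fps_of_poly (Poly (map (fps_nth F) [0..<m])) = F"
    using F by (intro fps_ext) (auto simp: coeff_Poly_eq nth_default_def)
  with \<open>q \<noteq> 0\<close> show ?thesis unfolding F_def by metis
qed

section \<open>Coordinates on tensor powers\<close>

lemma linear_sum':
  assumes "Vector_Spaces.linear s1 s2 L"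
  shows "L (\<Sum>i\<in>I. g i) = (\<Sum>i\<in>I. L (g i))"
  by (induction I rule: infinite_finite_induct) (simp_all add: linearD[OF assms])

lemma linear_sum_fun:
  assumes "vector_space s1" "vector_space s2" "\<And>i. i \<in> I \<Longrightarrow> Vector_Spaces.linear s1 s2 (g i)"
  shows "Vector_Spaces.linear s1 s2 (\<lambda>x. \<Sum>i\<in>I. g i x)"
  using assms(3)
  by (induction I rule: infinite_finite_induct) (auto intro: linear_zero'[OF assms(1,2)] linear_add')

text \<open>The trace of a projection onto \<open>U\<close> is the dimension of \<open>U\<close>.
  Besides linearity, only the behaviour on \<open>U\<close> and on the vectors \<open>e i\<close> is
  constrained, so the lemma can be applied to one tensor power inside the type of all
  tensors.\<close>

lemma (in vector_space) dim_image_projection: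
  assumes "subspace U" and fin: "finite I"
    and e: "\<And>i. Vector_Spaces.linear scale (*) (e' i)"
      "\<And>x. x \<in> U \<Longrightarrow> x = (\<Sum>i\<in>I. scale (e' i x) (e i))"
    and P: "Vector_Spaces.linear scale scale P" "\<And>i. i \<in> I \<Longrightarrow> P (e i) \<in> U" "\<And>x. x \<in> U \<Longrightarrow> P x = x"
  shows "(\<Sum>i\<in>I. e' i (P (e i))) = of_nat (dim U)"
proof -
  obtain C where C: "C \<subseteq> U" "independent C" "U \<subseteq> span C" "card C = dim U"
    by (rule basis_exists[of U])
  have "C \<subseteq> span (e ` I)"
  proof
    fix x assume "x \<in> C"
    then have "x = (\<Sum>i\<in>I. scale (e' i x) (e i))" using C e(2) by blast
    also have "\<dots> \<in> span (e ` I)" by (intro span_sum span_scale span_base) auto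
    finally show "x \<in> span (e ` I)" .
  qed
  with C fin have finC: "finite C"
    using independent_span_bound[of "e ` I" C] by auto
  define \<alpha> where "\<alpha> u x = representation C (P x) u" for u x
  have expand: "P (e i) = (\<Sum>u\<in>C. scale (\<alpha> u (e i)) u)" if "i \<in> I" for i
    unfolding \<alpha>_def
    using sum_representation_eq[OF C(2) _ finC order_refl, of "P (e i)"] C(3) P(2)[OF that] by auto
  have "(\<Sum>i\<in>I. e' i (P (e i))) = (\<Sum>i\<in>I. \<Sum>u\<in>C. \<alpha> u (e i) * e' i u)"
    by (intro sum.cong refl) (simp add: expand linear_sum'[OF e(1)] linearD(4)[OF e(1)])
  also have "\<dots> = (\<Sum>u\<in>C. \<Sum>i\<in>I. e' i u * \<alpha> u (e i))"
    by (subst sum.swap) (simp add: mult.commute)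
  also have "\<dots> = (\<Sum>u\<in>C. 1)"
  proof (intro sum.cong refl)
    fix u assume u: "u \<in> C"
    have in_span: "P (e i) \<in> span C" if "i \<in> I" for i
      using P(2)[OF that] C(3) by blast
    \<comment> \<open>The inner sum is the \<open>u\<close>-coefficient of \<open>P u = u\<close>,
      with \<open>u\<close> expanded in the \<open>e i\<close> before \<open>P\<close> is
      applied.\<close>
    have "u = P (\<Sum>i\<in>I. scale (e' i u) (e i))"
      using e(2)[of u] P(3)[of u] C(1) u by auto
    also have "\<dots> = (\<Sum>i\<in>I. scale (e' i u) (P (e i)))"
      by (simp add: linear_sum'[OF P(1)] linearD(4)[OF P(1)])
    finally have "1 = representation C (\<Sum>i\<in>I. scale (e' i u) (P (e i))) u"
      using representation_basis[OF C(2) u] by simp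
    also have "\<dots> = (\<Sum>i\<in>I. e' i u * \<alpha> u (e i))"
      using in_span by (simp add: representation_sum[OF C(2)] span_scale representation_scale[OF C(2)] \<alpha>_def)
    finally show "(\<Sum>i\<in>I. e' i u * \<alpha> u (e i)) = 1" ..
  qed
  also have "\<dots> = of_nat (dim U)" using C(4) by simp
  finally show ?thesis .
qed

section \<open>Basis tensors indexed by words, and their coordinates\<close>

definition words :: "'b set \<Rightarrow> nat \<Rightarrow> 'b list set"
  where "words B n = {bs. set bs \<subseteq> B \<and> length bs = n}"

lemma words_0 [simp]: "words B 0 = {[]}"
  by (auto simp: words_def)

lemma finite_words: "finite B \<Longrightarrow> finite (words B n)"
  unfolding words_def by (rule finite_lists_length_eq)

lemma sum_words_Suc: "(\<Sum>bs\<in>words B (Suc n). g bs) = (\<Sum>b\<in>B. \<Sum>bs\<in>words B n. g (b # bs))"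
proof -
  have "words B (Suc n) = (\<lambda>(b, bs). b # bs) ` (B \<times> words B n)"
    by (auto simp: words_def length_Suc_conv image_iff)
  then show ?thesis
    by (simp add: sum.reindex inj_on_def sum.cartesian_product case_prod_unfold)
qed

lemma module_tensor_scale: "module (tensor_scale :: 'k::field \<Rightarrow> ('v, 'k) tensor \<Rightarrow> _)"
  by (simp add: module_iff_vector_space vector_space_tensor_scale)

locale finite_tensor_space = tensor_space sV
  for sV :: "'k::field \<Rightarrow> 'v::ab_group_add \<Rightarrow> 'v" +
  fixes B :: "'v set"
  assumes finite_B: "finite B" and independent_B: "independent B" and span_B: "span B = UNIV"
begin

abbreviation \<beta> :: "'v \<Rightarrow> 'v \<Rightarrow> 'k"
  where "\<beta> b v \<equiv> representation B v b"

lemma beta_linear: "Vector_Spaces.linear sV (*) (\<beta> b)"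
  by (rule linearI')
    (simp_all add: vs vector_space_self representation_add[OF independent_B]
      representation_scale[OF independent_B] span_B)

lemma beta_expand: "(\<Sum>b\<in>B. sV (\<beta> b v) b) = v"
  by (rule sum_representation_eq) (simp_all add: independent_B finite_B span_B)

text \<open>A product of dual basis functionals, one for each letter. The value zero on lists of any
  other length makes it a multilinear family on all lists, as \<open>tensor_lift\<close>
  requires.\<close>

fun form :: "'v list \<Rightarrow> 'v list \<Rightarrow> 'k" where
  "form [] [] = 1"
| "form (b # bs) (v # vs) = \<beta> b v * form bs vs"
| "form _ _ = 0"

lemma form_multilinear: "multilinear sV (*) (form bs)"
proof -
  have "Vector_Spaces.linear sV (*) (\<lambda>v. form bs (us @ v # ws))" for us ws
  proof (induction bs arbitrary: us)
    case Nil
    have "form [] (us @ v # ws) = 0" for v by (cases us) simp_all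
    then show ?case by (simp add: linear_zero' vs vector_space_self)
  next
    case (Cons b bs)
    show ?case
    proof (cases us)
      case Nil
      then show ?thesis
        using linear_scale'[OF beta_linear, of "form bs ws" b] by (simp add: mult.commute)
    next
      case (Cons u us')
      then show ?thesis using linear_scale'[OF Cons.IH] by simp
    qed
  qed
  then show ?thesis by (simp add: multilinear_def)
qed

definition coord :: "'v list \<Rightarrow> ('v, 'k) tensor \<Rightarrow> 'k"
  where "coord bs = tensor_lift sV (*) (form bs)"

lemma coord_linear: "Vector_Spaces.linear tensor_scale (*) (coord bs)"
  unfolding coord_def by (rule tensor_lift_linear[OF form_multilinear])

lemma coord_tens [simp]: "coord bs (tens sV vs) = form bs vs"
  unfolding coord_def by (rule tensor_lift_tens[OF form_multilinear])

lemma coord_tm: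
  assumes "t \<in> T"
  shows "coord (b # bs) (tm (tens sV [v]) t) = \<beta> b v * coord bs t"
  using assms
  by (induction rule: tensor_algebra_induct)
    (simp_all add: tm_zero_right tm_add_right tm_scale_right tens_in tensor_algebra_scale
      linearD[OF coord_linear] algebra_simps)

lemma tens_expand: "tens sV vs = (\<Sum>bs\<in>words B (length vs). tensor_scale (form bs vs) (tens sV bs))"
proof (induction vs)
  case Nil
  show ?case by (simp add: vector_space.vector_space_assms(4)[OF vector_space_tensor_scale])
next
  case (Cons v vs)
  have l: "Vector_Spaces.linear sV tensor_scale (\<lambda>v. tens sV (v # vs))"
    using tens_linear[of "[]" vs] by simp
  have "tens sV (b # vs) = (\<Sum>bs\<in>words B (length vs). tensor_scale (form bs vs) (tens sV (b # bs)))" for b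
  proof -
    \<comment> \<open>Prefixing \<open>b\<close> is left multiplication by a tensor, which agrees on
      \<open>T\<close> with a linear map \<open>L\<close>; applying \<open>L\<close> to the
      induction hypothesis gives the expansion.\<close>
    obtain L where L: "Vector_Spaces.linear tensor_scale tensor_scale L"
      "\<And>y. y \<in> T \<Longrightarrow> tm (tens sV [b]) y = L y"
      using tm_linear2[OF tens_in] by metis
    have L_tens: "L (tens sV bs) = tens sV (b # bs)" for bs
      using L(2)[OF tens_in, of bs] by simp
    show ?thesis
      using arg_cong[OF Cons.IH, of L] by (simp add: L_tens linear_sum'[OF L(1)] linearD(4)[OF L(1)])
  qed
  note expand = this
  have "tens sV (v # vs) = (\<Sum>b\<in>B. tensor_scale (\<beta> b v) (tens sV (b # vs)))"
    using linear_sum'[OF l, of "\<lambda>b. sV (\<beta> b v) b" B] by (simp add: beta_expand linearD(4)[OF l])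
  also have "\<dots> = (\<Sum>b\<in>B. tensor_scale (\<beta> b v)
      (\<Sum>bs\<in>words B (length vs). tensor_scale (form bs vs) (tens sV (b # bs))))"
    by (intro sum.cong refl arg_cong[where f = "tensor_scale _"] expand)
  also have "\<dots> = (\<Sum>bs\<in>words B (length (v # vs)). tensor_scale (form bs (v # vs)) (tens sV bs))"
    by (simp add: sum_words_Suc module.scale_sum_right[OF module_tensor_scale] vector_space.vector_space_assms(3)[OF vector_space_tensor_scale])
  finally show ?case .
qed

lemma tensor_power_expand:
  assumes "x \<in> tensor_power sV n"
  shows "x = (\<Sum>bs\<in>words B n. tensor_scale (coord bs x) (tens sV bs))"
proof -
  interpret TS: vector_space "tensor_scale :: 'k \<Rightarrow> ('v, 'k) tensor \<Rightarrow> _"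
    by (rule vector_space_tensor_scale)
  show ?thesis
    using assms unfolding tensor_power_def
  proof (induction rule: TS.span_induct_alt)
    case base
    show ?case by (simp add: linearD(5)[OF coord_linear])
  next
    case (step c x y)
    then obtain vs where x: "x = tens sV vs" "length vs = n" by auto
    have "(\<Sum>bs\<in>words B n. tensor_scale (coord bs x) (tens sV bs)) = x"
      using tens_expand[of vs, unfolded x(2), symmetric] by (simp only: x(1) coord_tens)
    with step.IH show ?case
      by (simp add: linearD[OF coord_linear] TS.scale_left_distrib sum.distrib
          flip: TS.scale_scale TS.scale_sum_right)
  qed
qed

end

section \<open>Characters of tensor powers\<close>

lemma (in hopf_algebra) sw_zero:
  fixes sX :: "'k \<Rightarrow> 'x::ab_group_add \<Rightarrow> 'x"
  assumes "vector_space sX"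
  shows "sw sX (\<lambda>a b. 0) h = 0"
proof -
  have "bilinear_family (\<lambda>a b. 0 :: 'x) hs = 0" for hs :: "'h list"
    by (rule bilinear_family_cases[of hs]) simp_all
  then have "bilinear_family (\<lambda>a b. 0 :: 'x) = (\<lambda>hs :: 'h list. 0)" by (intro ext)
  then show ?thesis
    unfolding sweedler_def by (simp only: tensor_lift_zero[OF vsH assms comult_in_algebra])
qed

lemma (in hopf_algebra) sw_sum:
  assumes "vector_space sX" "\<And>i. i \<in> I \<Longrightarrow> bilin sH sX (F i)"
  shows "sw sX (\<lambda>a b. \<Sum>i\<in>I. F i a b) h = (\<Sum>i\<in>I. sw sX (F i) h)"
  using assms(2)
proof (induction I rule: infinite_finite_induct)
  case (insert i I)
  have b: "bilin sH sX (\<lambda>a b. \<Sum>i\<in>I. F i a b)"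
    by (intro bilinI linear_sum_fun vsH assms(1) bilinD(1)[OF insert.prems] bilinD(2)[OF insert.prems])
      simp_all
  have eq: "bilinear_family (\<lambda>a b. F i a b + (\<Sum>i\<in>I. F i a b)) =
      (\<lambda>hs. bilinear_family (F i) hs + bilinear_family (\<lambda>a b. \<Sum>i\<in>I. F i a b) hs)"
    by (rule ext, rule_tac hs = hs in bilinear_family_cases) simp_all
  have "sw sX (\<lambda>a b. F i a b + (\<Sum>i\<in>I. F i a b)) h = sw sX (F i) h + sw sX (\<lambda>a b. \<Sum>i\<in>I. F i a b) h"
    unfolding sweedler_def eq
    by (rule tensor_lift_add) (use b insert.prems in \<open>auto simp: bilinear_family_multilinear comult_in_algebra\<close>)
  with insert show ?case by simp
qed (simp_all add: sw_zero assms(1))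

locale finite_hopf_module = hopf_module sH \<Delta> \<epsilon> S sV \<rho> + F: finite_tensor_space sV B
  for sH :: "'k::field \<Rightarrow> 'h::ring_1 \<Rightarrow> 'h" and \<Delta> \<epsilon> S
    and sV :: "'k \<Rightarrow> 'v::ab_group_add \<Rightarrow> 'v" and \<rho> B
begin

text \<open>\<open>\<chi>\<close> is the character of the module, and \<open>tr n\<close> below is
  that of its n-th tensor power: both add up diagonal entries, in \<open>B\<close> and in the basis
  tensors of words.\<close>

definition \<chi> :: "'h \<Rightarrow> 'k"
  where "\<chi> h = (\<Sum>b\<in>B. F.\<beta> b (\<rho> h b))"

definition tr :: "nat \<Rightarrow> 'h \<Rightarrow> 'k"
  where "tr n h = (\<Sum>bs\<in>words B n. F.coord bs (D bs h))"

lemma chi_summand_linear: "Vector_Spaces.linear sH (*) (\<lambda>h. F.\<beta> b (\<rho> h v))"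
  by (rule linear_compose'[OF F.beta_linear rho_linear(1)])

lemma tr_summand_linear: "Vector_Spaces.linear sH (*) (\<lambda>h. F.coord bs (D vs h))"
  by (rule linear_compose'[OF F.coord_linear D_linear])

lemma chi_linear: "Vector_Spaces.linear sH (*) \<chi>"
  unfolding \<chi>_def by (intro linear_sum_fun vsH vector_space_self chi_summand_linear)

lemma tr_linear: "Vector_Spaces.linear sH (*) (tr n)"
  unfolding tr_def by (intro linear_sum_fun vsH vector_space_self tr_summand_linear)

lemma mult_bilin:
  assumes "Vector_Spaces.linear sH (*) f" "Vector_Spaces.linear sH (*) g"
  shows "bilin sH (*) (\<lambda>a b. f a * g b)"
  using linear_scale_left'[OF assms(1) vector_space_self] linear_scale'[OF assms(2)]
  by (intro bilinI) auto

lemma tr_0: "tr 0 h = \<epsilon> h"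
  by (simp add: tr_def linearD(4)[OF F.coord_linear])

text \<open>The diagonal entry at a word splits into that of the first letter and that of the
  remaining word, so the trace on a tensor product is a convolution. Together with
  \<open>tr_0\<close> this makes \<open>tr n\<close> the n-th convolution power of
  \<open>\<chi>\<close>.\<close>

lemma tr_Suc: "tr (Suc n) h = sw (*) (\<lambda>a b. \<chi> a * tr n b) h"
proof -
  have "F.coord (b # bs) (D (b # bs) h) = sw (*) (\<lambda>x y. F.\<beta> b (\<rho> x b) * F.coord bs (D bs y)) h" for b bs
    using sw_compose[OF D_bilin F.coord_linear] by (simp add: F.coord_tm D_in)
  then have "tr (Suc n) h =
      (\<Sum>b\<in>B. \<Sum>bs\<in>words B n. sw (*) (\<lambda>x y. F.\<beta> b (\<rho> x b) * F.coord bs (D bs y)) h)"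
    by (simp add: tr_def sum_words_Suc del: diagonal_action.simps)
  \<comment> \<open>As a single sum over pairs it can be moved inside \<open>sw\<close> at once and
    then factored as a product of two sums.\<close>
  also have "\<dots> = (\<Sum>(b, bs)\<in>B \<times> words B n. sw (*) (\<lambda>x y. F.\<beta> b (\<rho> x b) * F.coord bs (D bs y)) h)"
    by (simp add: sum.cartesian_product)
  also have "\<dots> = sw (*) (\<lambda>x y. \<Sum>(b, bs)\<in>B \<times> words B n. F.\<beta> b (\<rho> x b) * F.coord bs (D bs y)) h"
    unfolding case_prod_unfold
    by (rule sw_sum[symmetric]) (intro vector_space_self mult_bilin chi_summand_linear tr_summand_linear)+
  also have "(\<lambda>x y. \<Sum>(b, bs)\<in>B \<times> words B n. F.\<beta> b (\<rho> x b) * F.coord bs (D bs y)) = (\<lambda>x y. \<chi> x * tr n y)"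
    by (simp add: \<chi>_def tr_def sum_product sum.cartesian_product)
  finally show ?thesis .
qed

section \<open>Contracting the coproduct with the character\<close>

definition shift :: "'h \<Rightarrow> 'h"
  where "shift h = sw sH (\<lambda>a b. sH (\<chi> a) b) h"

lemma scale_bilin:
  assumes "Vector_Spaces.linear sH (*) f"
  shows "bilin sH sH (\<lambda>a b. sH (f a) b)"
  by (intro bilinI linear_scale_left' assms linear_scale' vsH) (simp add: linear_ident)

lemma shift_linear: "Vector_Spaces.linear sH sH shift"
  using sw_linear[OF scale_bilin[OF chi_linear]] by (simp add: shift_def[abs_def])

lemma shift_power_linear: "Vector_Spaces.linear sH sH (shift ^^ n)"
proof (induction n)
  case 0
  show ?case using linear_ident by (simp add: id_def)
next
  case (Suc n)
  then show ?case using linear_compose'[OF shift_linear] by (simp add: comp_def)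
qed

text \<open>Convolution powers of a functional become powers of one linear operator on the Hopf
  algebra; coassociativity regroups the legs.\<close>

lemma shift_power: "(shift ^^ n) h = sw sH (\<lambda>a b. sH (tr n a) b) h"
proof (induction n arbitrary: h)
  case 0
  show ?case by (simp add: tr_0 counit_left)
next
  case (Suc n)
  note m = mult_bilin[OF chi_linear tr_linear]
  have t1: "Vector_Spaces.linear sH sH (\<lambda>a. sH (\<chi> a * tr n b) c)"
    "Vector_Spaces.linear sH sH (\<lambda>b. sH (\<chi> a * tr n b) c)"
    "Vector_Spaces.linear sH sH (\<lambda>c. sH (\<chi> a * tr n b) c)" for a b c
    by (rule linear_scale_left'[OF bilinD(1)[OF m] vsH] linear_scale_left'[OF bilinD(2)[OF m] vsH]
        linear_scale'[OF linear_ident])+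
  \<comment> \<open>Peeling off the innermost \<open>shift\<close> leaves the induction hypothesis
    to act on the right leg \<open>b\<close>.\<close>
  have "(shift ^^ Suc n) h = (shift ^^ n) (shift h)"
    by (simp add: funpow_swap1)
  also have "\<dots> = sw sH (\<lambda>a b. (shift ^^ n) (sH (\<chi> a) b)) h"
    unfolding shift_def[of h] by (rule sw_compose[OF scale_bilin[OF chi_linear] shift_power_linear])
  also have "\<dots> = sw sH (\<lambda>a b. sw sH (\<lambda>b1 b2. sH (\<chi> a * tr n b1) b2) b) h"
    by (simp add: Suc.IH linearD(4)[OF shift_power_linear]
        sw_compose[OF scale_bilin[OF tr_linear] linear_scale'[OF linear_ident]])
  also have "\<dots> = sw sH (\<lambda>a b. sw sH (\<lambda>a1 a2. sH (\<chi> a1 * tr n a2) b) a) h"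
    by (rule sw_coassoc[symmetric]) (rule t1)+
  also have "\<dots> = sw sH (\<lambda>a b. sH (tr (Suc n) a) b) h"
    by (simp add: tr_Suc sw_compose[OF m
          linear_scale_left'[OF vector_space.linear_ident[OF vector_space_self] vsH]])
  finally show ?case .
qed

text \<open>The counit removes the remaining right leg. The traces are thus read off the orbit of
  \<open>h\<close> under one operator by one functional.\<close>

lemma tr_eq_counit_shift: "tr n h = \<epsilon> ((shift ^^ n) h)"
proof -
  have "\<epsilon> ((shift ^^ n) h) = sw (*) (\<lambda>a b. \<epsilon> b * tr n a) h"
    unfolding shift_power sw_compose[OF scale_bilin[OF tr_linear] counit_linear]
    by (simp add: linearD(4)[OF counit_linear] mult.commute)
  then show ?thesis by (simp add: sw_counit_right[OF tr_linear])
qed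

text \<open>A tensor has finitely many right legs. The same \<open>Y\<close> must serve every
  \<open>\<phi>\<close>, because the n-th iterate of \<open>shift\<close> contracts with its own
  functional \<open>tr n\<close>.\<close>

lemma right_legs_span:
  assumes "t \<in> tensor_algebra sH"
  shows "\<exists>Y. finite Y \<and> (\<forall>\<phi>. Vector_Spaces.linear sH (*) \<phi> \<longrightarrow>
    tensor_lift sH sH (bilinear_family (\<lambda>a b. sH (\<phi> a) b)) t \<in> span Y)"
  using assms
proof (induction rule: tensor_algebra_induct)
  case zero
  have "tensor_lift sH sH (bilinear_family (\<lambda>a b. sH (\<phi> a) b)) 0 = 0"
    if "Vector_Spaces.linear sH (*) \<phi>" for \<phi>
    by (rule linearD(5)[OF tensor_lift_linear[OF bilinear_family_multilinear[OF scale_bilin[OF that]]]])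
  then show ?case by (intro exI[of _ "{}"]) simp
next
  case (step c hs y)
  then obtain Y where Y: "finite Y" "\<And>\<phi>. Vector_Spaces.linear sH (*) \<phi> \<Longrightarrow>
    tensor_lift sH sH (bilinear_family (\<lambda>a b. sH (\<phi> a) b)) y \<in> span Y" by blast
  \<comment> \<open>For a pair \<open>hs\<close>, the new right leg is \<open>hs ! 1\<close>. A list
    of another length contributes zero, so its value of \<open>hs ! 1\<close> is harmless.\<close>
  have "tensor_lift sH sH (bilinear_family (\<lambda>a b. sH (\<phi> a) b)) (tensor_scale c (tens sH hs) + y)
      \<in> span (insert (hs ! 1) Y)" if \<phi>: "Vector_Spaces.linear sH (*) \<phi>" for \<phi>
  proof -
    note m = bilinear_family_multilinear[OF scale_bilin[OF \<phi>]]
    have "bilinear_family (\<lambda>a b. sH (\<phi> a) b) hs \<in> span (insert (hs ! 1) Y)"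
      by (rule bilinear_family_cases[of hs]) (auto intro: span_zero span_scale span_base)
    moreover have "tensor_lift sH sH (bilinear_family (\<lambda>a b. sH (\<phi> a) b)) y \<in> span (insert (hs ! 1) Y)"
      using Y(2)[OF \<phi>] span_mono[of Y "insert (hs ! 1) Y"] by auto
    ultimately show ?thesis
      by (simp add: linearD[OF tensor_lift_linear[OF m]] tensor_lift_tens[OF m] span_add span_scale)
  qed
  with Y(1) show ?case by (intro exI[of _ "insert (hs ! 1) Y"]) simp
qed

lemma tr_recurrence:
  obtains c j m where "c j \<noteq> 0" "j \<le> m" "\<And>n. (\<Sum>i\<le>m. c i * tr (i + n) h) = 0"
proof -
  \<comment> \<open>One finite set spans all iterates, since each is a contraction of the single
    tensor \<open>\<Delta> h\<close>.\<close>
  obtain Y where Y: "finite Y" "\<And>n. (shift ^^ n) h \<in> span Y"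
    using right_legs_span[OF comult_in_algebra[of h]] tr_linear
    unfolding shift_power sweedler_def by blast
  obtain c where c: "\<exists>i\<le>card Y. c i \<noteq> 0" "(\<Sum>i\<le>card Y. sH (c i) ((shift ^^ i) h)) = 0"
    by (rule finite_span_dependent_family[OF Y])
  have "(\<Sum>i\<le>card Y. c i * tr (i + n) h) = 0" for n
  proof -
    \<comment> \<open>Applying this functional to the one dependence among the iterates gives the
      recurrence at offset \<open>n\<close>.\<close>
    have L: "Vector_Spaces.linear sH (*) (\<lambda>x. \<epsilon> ((shift ^^ n) x))"
      by (rule linear_compose'[OF counit_linear shift_power_linear])
    have "(shift ^^ (i + n)) h = (shift ^^ n) ((shift ^^ i) h)" for i
      by (metis add.commute comp_apply funpow_add)
    then have "(\<Sum>i\<le>card Y. c i * tr (i + n) h) = \<epsilon> ((shift ^^ n) (\<Sum>i\<le>card Y. sH (c i) ((shift ^^ i) h)))"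
      by (simp add: tr_eq_counit_shift linear_sum'[OF L] linearD(4)[OF L])
    then show ?thesis by (simp add: c(2) linearD(5)[OF L])
  qed
  with c(1) that show thesis by blast
qed

section \<open>Preservation of degree, and invariants as the image of a projection\<close>

lemma D_in_power: "D vs h \<in> tensor_power sV (length vs)"
proof (induction vs arbitrary: h)
  interpret TS: vector_space "tensor_scale :: 'k \<Rightarrow> ('v, 'k) tensor \<Rightarrow> _"
    by (rule vector_space_tensor_scale)
  case Nil
  show ?case by (auto simp: tensor_power_def intro: TS.span_scale TS.span_base)
next
  interpret TS: vector_space "tensor_scale :: 'k \<Rightarrow> ('v, 'k) tensor \<Rightarrow> _"
    by (rule vector_space_tensor_scale)
  case (Cons v vs)
  have "tm (tens sV [u]) t \<in> tensor_power sV (Suc n)" if "t \<in> tensor_power sV n" for u t n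
  proof -
    \<comment> \<open>Membership in \<open>T\<close> is carried along because \<open>tm\<close> is
      known to be linear in its second argument only on \<open>T\<close>.\<close>
    have "t \<in> T \<and> tm (tens sV [u]) t \<in> tensor_power sV (Suc n)"
      using that unfolding tensor_power_def
    proof (induction rule: TS.span_induct_alt)
      case base
      show ?case by (simp add: TV.tm_zero_right tens_in tensor_algebra_zero TS.span_zero)
    next
      case (step c x y)
      then obtain vs where "x = tens sV vs" "length vs = n" by auto
      moreover have "tens sV (u # vs) \<in> TS.span {tens sV vs |vs. length vs = Suc n}"
        by (rule TS.span_base) (use \<open>length vs = n\<close> in \<open>auto intro: exI[of _ "u # vs"]\<close>)
      ultimately show ?case
        using step.IH
        by (simp add: TV.tm_add_right TV.tm_scale_right tens_in tensor_algebra_scale tensor_algebra_add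
            TS.span_add TS.span_scale)
    qed
    then show ?thesis ..
  qed
  with Cons.IH show ?case
    by (simp add: sw_closed[OF D_bilin] tensor_power_def)
qed

lemma induced_in_power:
  assumes "x \<in> tensor_power sV n"
  shows "induced h x \<in> tensor_power sV n"
proof -
  interpret TS: vector_space "tensor_scale :: 'k \<Rightarrow> ('v, 'k) tensor \<Rightarrow> _"
    by (rule vector_space_tensor_scale)
  show ?thesis
    using assms unfolding tensor_power_def
  proof (induction rule: TS.span_induct_alt)
    case base
    show ?case by (simp add: linearD(5)[OF induced_linear] TS.span_zero)
  next
    case (step c x y)
    then obtain vs where "x = tens sV vs" "length vs = n" by auto
    then have "induced h x \<in> TS.span {tens sV vs |vs. length vs = n}"
      using D_in_power[of vs h] by (simp add: tensor_power_def)
    with step.IH show ?case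
      by (simp add: linearD[OF induced_linear] TS.span_add TS.span_scale)
  qed
qed

text \<open>The first property of \<open>\<Lambda>\<close> places its image in the invariants and
  the second makes it fix them, so the dimension is the trace of a projection.\<close>

lemma dim_invariants:
  assumes \<Lambda>: "\<And>h. h * \<Lambda> = sH (\<epsilon> h) \<Lambda>" "\<epsilon> \<Lambda> = 1"
  shows "of_nat (vector_space.dim tensor_scale (invariants \<epsilon> tensor_scale (tensor_power sV n) induced)) = tr n \<Lambda>"
proof -
  interpret TS: vector_space "tensor_scale :: 'k \<Rightarrow> ('v, 'k) tensor \<Rightarrow> _"
    by (rule vector_space_tensor_scale)
  let ?I = "invariants \<epsilon> tensor_scale (tensor_power sV n) induced"
  have sub: "TS.subspace (tensor_power sV n)"
    by (simp add: tensor_power_def TS.subspace_span)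
  have subspace: "TS.subspace ?I"
    unfolding TS.subspace_def invariants_def
    using sub[unfolded TS.subspace_def]
    by (auto simp: linearD[OF induced_linear] TS.scale_right_distrib mult.commute)
  have into: "induced \<Lambda> x \<in> ?I" if x: "x \<in> tensor_power sV n" for x
  proof -
    have "x \<in> T" using x tensor_power_subset by blast
    then have "induced h (induced \<Lambda> x) = tensor_scale (\<epsilon> h) (induced \<Lambda> x)" for h
      using linearD(4)[OF induced_linear_left, of x "\<epsilon> h" \<Lambda>] by (simp add: \<Lambda>(1) flip: induced_act_mult)
    then show ?thesis by (simp add: invariants_def induced_in_power[OF x])
  qed
  have basis: "tens sV bs \<in> tensor_power sV n" if "bs \<in> words B n" for bs
    using that by (auto simp: tensor_power_def words_def intro: TS.span_base)
  have fixed: "induced \<Lambda> x = x" if "x \<in> ?I" for x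
    using that by (simp add: invariants_def \<Lambda>(2))
  have expand: "x = (\<Sum>bs\<in>words B n. tensor_scale (F.coord bs x) (tens sV bs))" if "x \<in> ?I" for x
    using that by (intro F.tensor_power_expand) (simp add: invariants_def)
  have "(\<Sum>bs\<in>words B n. F.coord bs (induced \<Lambda> (tens sV bs))) = of_nat (TS.dim ?I)"
    by (rule TS.dim_image_projection[OF subspace finite_words[OF F.finite_B] F.coord_linear expand
          induced_linear into[OF basis] fixed])
  then show ?thesis by (simp add: tr_def)
qed

end

section \<open>A normalized integral from semisimplicity\<close>

lemma (in hopf_algebra) normalized_integral_exists:
  assumes "semisimple_algebra TYPE('h)"
  obtains \<Lambda> where "\<And>h. h * \<Lambda> = sH (\<epsilon> h) \<Lambda>" "\<epsilon> \<Lambda> = 1"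
proof -
  let ?K = "{h. \<epsilon> h = 0}"
  have "left_ideal ?K"
    by (auto simp: left_ideal_def linearD[OF counit_linear] counit_mult)
  then obtain J where J: "left_ideal J" "?K \<inter> J = {0}" "\<And>x. \<exists>i\<in>?K. \<exists>j\<in>J. x = i + j"
    using assms unfolding semisimple_algebra_def by metis
  \<comment> \<open>\<open>\<Lambda>\<close> is the component of 1 in a complement of the kernel of
    the counit.\<close>
  from J(3)[of 1] obtain i \<Lambda> where \<Lambda>: "\<epsilon> i = 0" "\<Lambda> \<in> J" "1 = i + \<Lambda>" by auto
  have 1: "\<epsilon> \<Lambda> = 1"
    using arg_cong[OF \<Lambda>(3), of \<epsilon>] by (simp add: linearD[OF counit_linear] \<Lambda>(1) counit_one)
  have "h * \<Lambda> = sH (\<epsilon> h) \<Lambda>" for h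
  proof -
    \<comment> \<open>Since \<open>g\<close> lies in the kernel of \<open>\<epsilon>\<close>, the
      product \<open>g * \<Lambda>\<close> lies both in that kernel and in \<open>J\<close>, hence
      is zero.\<close>
    define g where "g = h + sH (- \<epsilon> h) 1"
    have "g * \<Lambda> \<in> J" using J(1) \<Lambda>(2) by (simp add: left_ideal_def)
    moreover have "\<epsilon> (g * \<Lambda>) = 0"
      by (simp only: g_def counit_mult linearD[OF counit_linear] counit_one) simp
    ultimately have "g * \<Lambda> = 0" using J(2) by blast
    then show ?thesis by (simp add: g_def left_diff_distrib scale_mult_left)
  qed
  with 1 that show thesis by blast
qed

section \<open>Rationality of the Hilbert series\<close>

theorem theorem4:
  fixes sH :: "'k::field_char_0 \<Rightarrow> 'h::ring_1 \<Rightarrow> 'h"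
    and \<Delta> :: "'h \<Rightarrow> ('h, 'k) tensor" and \<epsilon> :: "'h \<Rightarrow> 'k" and S :: "'h \<Rightarrow> 'h"
    and sV :: "'k \<Rightarrow> 'v::ab_group_add \<Rightarrow> 'v"
    and act :: "'h \<Rightarrow> ('v, 'k) tensor \<Rightarrow> ('v, 'k) tensor"
  assumes "hopf_algebra sH \<Delta> \<epsilon> S"
    and "semisimple_algebra TYPE('h)"
    and "vector_space sV"
    and "\<exists>B. finite B \<and> module.span sV B = UNIV"
    and "linear_action sH \<Delta> \<epsilon> sV act"
  shows "\<exists>p q :: rat poly. q \<noteq> 0 \<and>
    fps_of_poly q *
      hilbert_series tensor_scale (\<lambda>n. invariants \<epsilon> tensor_scale (tensor_power sV n) act) =
    fps_of_poly p"
proof -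
  interpret V: vector_space sV by fact
  interpret TA: module_algebra sH \<Delta> \<epsilon> tensor_scale "tensor_algebra sV" "tensor_mult sV" "tens sV []" act
    using assms(5) by (simp add: linear_action_def)
  obtain \<rho> where \<rho>: "algebra_module sH sV UNIV \<rho>"
    "\<And>h vs. act h (tens sV vs) = diagonal_action sH \<Delta> \<epsilon> sV \<rho> vs h"
    using assms(5) by (auto simp: linear_action_def)
  obtain B0 where B0: "finite B0" "V.span B0 = UNIV" using assms(4) by blast
  obtain B where B: "B \<subseteq> B0" "V.independent B" "B0 \<subseteq> V.span B"
    by (rule V.maximal_independent_subset)
  have "finite B" using B(1) B0(1) by (rule finite_subset)
  moreover have "V.span B = UNIV"
    using V.span_minimal[OF B(3) V.subspace_span] B0(2) by blast
  ultimately interpret finite_hopf_module sH \<Delta> \<epsilon> S sV \<rho> B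
    using assms(1,3) \<rho>(1) B(2)
    by (simp add: finite_hopf_module_def hopf_module_def finite_tensor_space_def tensor_space_def
        finite_tensor_space_axioms_def)
  \<comment> \<open>The two actions are compared only on the tensor algebra, which contains all the
    invariants in question; outside it \<open>act\<close> is arbitrary.\<close>
  have act: "act h x = induced h x" if "x \<in> tensor_algebra sV" for h x
    using that
  proof (induction rule: tensor_algebra_induct)
    case zero
    show ?case
      using TA.act_scale_right[of 0 h 0] by (simp add: tensor_algebra_zero linearD(5)[OF induced_linear])
  next
    case (step c vs y)
    then show ?case
      by (simp add: TA.act_add_right TA.act_scale_right tens_in tensor_algebra_scale \<rho>(2)
          linearD[OF induced_linear])
  qed
  obtain \<Lambda> where \<Lambda>: "\<And>h. h * \<Lambda> = sH (\<epsilon> h) \<Lambda>" "\<epsilon> \<Lambda> = 1"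
    using normalized_integral_exists[OF assms(2)] by blast
  define a where "a n = vector_space.dim tensor_scale
    (invariants \<epsilon> tensor_scale (tensor_power sV n) act)" for n
  have "invariants \<epsilon> tensor_scale (tensor_power sV n) act =
      invariants \<epsilon> tensor_scale (tensor_power sV n) induced" for n
    using act tensor_power_subset[of sV n] by (auto simp: invariants_def)
  then have a: "tr n \<Lambda> = of_nat (a n)" for n
    using dim_invariants[OF \<Lambda>] by (simp add: a_def)
  \<comment> \<open>At \<open>\<Lambda>\<close> the traces are dimensions, so this recurrence has
    coefficients in \<open>'k\<close> but natural numbers as its terms.\<close>
  obtain c j m where c: "c j \<noteq> 0" "j \<le> m" "\<And>n. (\<Sum>i\<le>m. c i * of_nat (a (i + n))) = (0 :: 'k)"
    using tr_recurrence[of \<Lambda>] unfolding a by blast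
  obtain d :: "nat \<Rightarrow> rat" where d: "d j \<noteq> 0" "\<And>n. (\<Sum>i\<le>m. d i * of_nat (a (i + n))) = 0"
    using rational_recurrence[OF c] by blast
  show ?thesis
    using linear_recurrence_rational[where a = "\<lambda>n. of_nat (a n)", OF d(1) c(2) d(2)]
    unfolding hilbert_series_def a_def by blast
qed

end
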